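(* Let $n\in\{1,3,7\}$ and let $m:\mathbb{S}^n\times\mathbb{S}^n\to\mathbb{S}^n$ be the multiplication map $m(x,y)=xy$ of unit complex numbers ($n=1$), unit quaternions ($n=3$) or unit octonions ($n=7$). Then every (Lipschitz) map $f:\mathbb{S}^n\times\mathbb{S}^n\to\mathbb{S}^n$ homotopic to $m$ has Lipschitz constant $L_f(\mathbb{S}^n\times\mathbb{S}^n)\ge\sqrt{2}$, and equality holds if and only if $f$ is isometric to $m$.
   Context: $\mathbb{S}^n$ denotes the unit round sphere in $\mathbb{R}^{n+1}$ (identified with the unit complex numbers, quaternions or octonions for $n=1,3,7$), and $\mathbb{S}^n\times\mathbb{S}^n$ carries the product Riemannian metric; distances are the Riemannian (geodesic) distances. For a map $g:M\to N$ between metric spaces, its Lipschitz constant $L_g(M)$ is the smallest $C$ with $d_N(g(a),g(b))\le C\,d_M(a,b)$ for all $a,b\in M$. Two maps $f_1,f_2:M\to N$ are isometric if there exist isometries $g_M:M\to M$ and $g_N:N\to N$ with $g_N\circ f_1=f_2\circ g_M$. *)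

theory Defs
  imports "HOL-Analysis.Analysis"
begin

text \<open>Points of R^(n+1) are represented as functions nat => real vanishing at indices > n.\<close>

definition sphere_pts :: "nat \<Rightarrow> (nat \<Rightarrow> real) set" where
  "sphere_pts n = {x. (\<forall>i>n. x i = 0) \<and> (\<Sum>i\<le>n. (x i)^2) = 1}"

definition sph_dist :: "nat \<Rightarrow> (nat \<Rightarrow> real) \<Rightarrow> (nat \<Rightarrow> real) \<Rightarrow> real" where
  "sph_dist n x y = arccos (\<Sum>i\<le>n. x i * y i)"

definition sphprod_dist :: "nat \<Rightarrow> (nat \<Rightarrow> real) \<times> (nat \<Rightarrow> real) \<Rightarrow> (nat \<Rightarrow> real) \<times> (nat \<Rightarrow> real) \<Rightarrow> real" where
  "sphprod_dist n p q = sqrt ((sph_dist n (fst p) (fst q))^2 + (sph_dist n (snd p) (snd q))^2)"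

text \<open>Cayley--Dickson algebras on R^(2^k): k=1 complex numbers, k=2 quaternions, k=3 octonions,
  with (a,b)(c,d) = (ac - conj(d) b, d a + b conj(c)).\<close>
definition cd_conj :: "nat \<Rightarrow> (nat \<Rightarrow> real) \<Rightarrow> (nat \<Rightarrow> real)" where
  "cd_conj k x = (\<lambda>i. if i = 0 then x 0 else if i < 2^k then - x i else 0)"

fun cd_mult :: "nat \<Rightarrow> (nat \<Rightarrow> real) \<Rightarrow> (nat \<Rightarrow> real) \<Rightarrow> (nat \<Rightarrow> real)" where
  "cd_mult 0 x y = (\<lambda>i. if i = 0 then x 0 * y 0 else 0)"
| "cd_mult (Suc k) x y =
     (let h = 2^k;
          a = (\<lambda>i. if i < h then x i else 0);
          b = (\<lambda>i. if i < h then x (i + h) else 0);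
          c = (\<lambda>i. if i < h then y i else 0);
          d = (\<lambda>i. if i < h then y (i + h) else 0);
          L = (\<lambda>i. cd_mult k a c i - cd_mult k (cd_conj k d) b i);
          H = (\<lambda>i. cd_mult k d a i + cd_mult k b (cd_conj k c) i)
      in (\<lambda>i. if i < h then L i else if i < 2 * h then H (i - h) else 0))"

definition sph_mult :: "nat \<Rightarrow> (nat \<Rightarrow> real) \<times> (nat \<Rightarrow> real) \<Rightarrow> (nat \<Rightarrow> real)" where
  "sph_mult n p = cd_mult (if n = 1 then 1 else if n = 3 then 2 else 3) (fst p) (snd p)"

definition lip_const :: "('a \<Rightarrow> 'a \<Rightarrow> real) \<Rightarrow> ('b \<Rightarrow> 'b \<Rightarrow> real) \<Rightarrow> 'a set \<Rightarrow> ('a \<Rightarrow> 'b) \<Rightarrow> real" where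
  "lip_const dM dN A g = Inf {C. C \<ge> 0 \<and> (\<forall>a\<in>A. \<forall>b\<in>A. dN (g a) (g b) \<le> C * dM a b)}"

definition is_lipschitz :: "('a \<Rightarrow> 'a \<Rightarrow> real) \<Rightarrow> ('b \<Rightarrow> 'b \<Rightarrow> real) \<Rightarrow> 'a set \<Rightarrow> ('a \<Rightarrow> 'b) \<Rightarrow> bool" where
  "is_lipschitz dM dN A g \<longleftrightarrow> (\<exists>C\<ge>0. \<forall>a\<in>A. \<forall>b\<in>A. dN (g a) (g b) \<le> C * dM a b)"

definition isometry_of :: "('a \<Rightarrow> 'a \<Rightarrow> real) \<Rightarrow> 'a set \<Rightarrow> ('a \<Rightarrow> 'a) \<Rightarrow> bool" where
  "isometry_of d A g \<longleftrightarrow> g ` A = A \<and> (\<forall>a\<in>A. \<forall>b\<in>A. d (g a) (g b) = d a b)"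

definition maps_isometric :: "('a \<Rightarrow> 'a \<Rightarrow> real) \<Rightarrow> 'a set \<Rightarrow> ('b \<Rightarrow> 'b \<Rightarrow> real) \<Rightarrow> 'b set
    \<Rightarrow> ('a \<Rightarrow> 'b) \<Rightarrow> ('a \<Rightarrow> 'b) \<Rightarrow> bool" where
  "maps_isometric dM M dN N f1 f2 \<longleftrightarrow>
     (\<exists>gM gN. isometry_of dM M gM \<and> isometry_of dN N gN \<and> (\<forall>x\<in>M. gN (f1 x) = f2 (gM x)))"

end

theory Submission
  imports Defs
begin

text \<open>Write \<open>d\<close> for the angular metric and let \<open>f\<close> have Lipschitz constant \<open>L\<close>. If \<open>\<phi>\<close> is a nullhomotopic
  self-map of the sphere, then \<open>p \<mapsto> f (p, \<phi> p)\<close> is homotopic to \<open>p \<mapsto> p \<cdot> 1 = p\<close>, hence onto. Taking for \<open>\<phi>\<close>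
  a map that runs along a geodesic from \<open>y\<close> to \<open>y'\<close> while \<open>p\<close> runs from \<open>x\<close> to \<open>- x\<close> and hitting the
  antipode of \<open>f (x, y)\<close> yields
  \<open>2 \<pi> \<le> L sqrt (\<pi>\<^sup>2 + d(y, y')\<^sup>2) + d(f (x, y), f (- x, y'))\<close>.
  Choosing \<open>y'\<close> with \<open>f (- x, y') = f (x, y)\<close> gives \<open>L \<ge> sqrt 2\<close>. If \<open>L = sqrt 2\<close> it also gives \<open>y' = - y\<close>, so
  \<open>f (- x, - y) = f (x, y)\<close>, and the inequality becomes
  \<open>2 \<pi> - sqrt 2 sqrt (\<pi>\<^sup>2 + (\<pi> - d(y, y'))\<^sup>2) \<le> d(f (x, y), f (x, y'))\<close>, whose left side is
  \<open>d(y, y')\<close> to first order. So the inverse of \<open>f (x, \<cdot>)\<close> is nonexpanding, hence an isometry. By symmetry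
  \<open>f\<close> is the restriction of a normed bilinear multiplication, which after rotating the factors has
  a unit, and Cayley--Dickson doubling identifies it with the standard one.\<close>

section \<open>The angular metric on the unit sphere\<close>

definition ang :: "'a::real_inner \<Rightarrow> 'a \<Rightarrow> real" where
  "ang x y = arccos (x \<bullet> y)"

lemma inner_unit_bounds:
  assumes "norm x = 1" "norm y = 1"
  shows "x \<bullet> y \<in> {-1..1}"
  using Cauchy_Schwarz_ineq2[of x y] assms by auto

lemma cos_ang [simp]:
  assumes "norm x = 1" "norm y = 1"
  shows "cos (ang x y) = x \<bullet> y"
  using inner_unit_bounds[OF assms] by (simp add: ang_def)

lemma ang_bounds:
  assumes "norm x = 1" "norm y = 1"
  shows "0 \<le> ang x y" "ang x y \<le> pi"
  using inner_unit_bounds[OF assms] arccos_bounded by (auto simp: ang_def)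

lemma ang_commute: "ang x y = ang y x"
  by (simp add: ang_def inner_commute)

lemma ang_self [simp]: "norm x = 1 \<Longrightarrow> ang x x = 0"
  by (simp add: ang_def norm_eq_1)

lemma ang_minus_left:
  assumes "norm x = 1" "norm y = 1"
  shows "ang (- x) y = pi - ang x y"
  using inner_unit_bounds[OF assms] by (simp add: ang_def arccos_minus)

lemma ang_minus_right:
  assumes "norm x = 1" "norm y = 1"
  shows "ang x (- y) = pi - ang x y"
  using inner_unit_bounds[OF assms] by (simp add: ang_def arccos_minus)

lemma ang_eq_0_iff:
  assumes "norm x = 1" "norm y = 1"
  shows "ang x y = 0 \<longleftrightarrow> x = y"
proof
  assume "ang x y = 0"
  then have "x \<bullet> y = 1"
    using cos_ang[OF assms] by simp
  then have "(x - y) \<bullet> (x - y) = 0"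
    using assms by (simp add: inner_diff inner_commute norm_eq_1)
  then show "x = y" by simp
qed (use assms in auto)

lemma ang_eq_pi_iff:
  assumes "norm x = 1" "norm y = 1"
  shows "ang x y = pi \<longleftrightarrow> y = - x"
  using ang_minus_left[OF assms] ang_eq_0_iff[of "- x" y] assms by auto

text \<open>Removing the components along \<open>y\<close> leaves vectors of norms
  \<open>sin ?a\<close> and \<open>sin ?b\<close>. Cauchy-Schwarz for these bounds
  \<open>cos (?a + ?b)\<close> above by \<open>x \<bullet> z\<close>, and \<open>cos\<close>
  decreases on [0, pi].\<close>

lemma ang_triangle:
  assumes x: "norm x = 1" and y: "norm y = 1" and z: "norm z = 1"
  shows "ang x z \<le> ang x y + ang y z"
proof (cases "ang x y + ang y z \<le> pi")
  case True
  let ?a = "ang x y" and ?b = "ang y z"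
  define p where "p = x - (x \<bullet> y) *\<^sub>R y"
  define q where "q = z - (y \<bullet> z) *\<^sub>R y"
  have yy: "y \<bullet> y = 1" "x \<bullet> x = 1" "z \<bullet> z = 1"
    using x y z by (auto simp: norm_eq_1)
  have sin_nonneg: "0 \<le> sin ?a" "0 \<le> sin ?b"
    using ang_bounds x y z by (auto intro!: sin_ge_zero)
  have "p \<bullet> p = sin ?a * sin ?a"
    using x y z by (simp add: sin_squared_eq[unfolded power2_eq_square] p_def inner_diff inner_commute yy)
  then have np: "norm p = sin ?a"
    using sin_nonneg by (simp add: norm_eq_sqrt_inner)
  have "q \<bullet> q = sin ?b * sin ?b"
    using x y z by (simp add: sin_squared_eq[unfolded power2_eq_square] q_def inner_diff inner_commute yy)
  then have nq: "norm q = sin ?b"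
    using sin_nonneg by (simp add: norm_eq_sqrt_inner)
  have "cos (?a + ?b) = (x \<bullet> y) * (y \<bullet> z) - norm p * norm q"
    using x y z by (simp add: cos_add np nq)
  also have "\<dots> \<le> (x \<bullet> y) * (y \<bullet> z) + p \<bullet> q"
    using Cauchy_Schwarz_ineq2[of p q] by linarith
  also have "\<dots> = x \<bullet> z"
    by (simp add: p_def q_def inner_diff inner_commute yy algebra_simps)
  also have "\<dots> = cos (ang x z)"
    using x z by simp
  finally show ?thesis
    using True ang_bounds x y z by (subst (asm) cos_mono_le_eq) auto
next
  case False
  then show ?thesis using ang_bounds[OF x z] by linarith
qed

lemma ang_orthogonal_transformation:
  assumes "orthogonal_transformation g"
  shows "ang (g x) (g y) = ang x y"
  using assms by (simp add: ang_def orthogonal_transformation_def)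

section \<open>Unit-speed great circles and nonexpanding maps of the sphere\<close>

definition geod :: "'a::real_inner \<Rightarrow> 'a \<Rightarrow> real \<Rightarrow> 'a" where
  "geod y u t = cos t *\<^sub>R y + sin t *\<^sub>R u"

lemma continuous_on_geod [continuous_intros]:
  fixes g :: "'b::topological_space \<Rightarrow> real"
  shows "continuous_on A g \<Longrightarrow> continuous_on A (\<lambda>x. geod y u (g x))"
  unfolding geod_def
  by (intro continuous_intros continuous_on_compose2[OF continuous_on_cos[OF continuous_on_id]]
      continuous_on_compose2[OF continuous_on_sin[OF continuous_on_id]]) auto

lemma geod_0 [simp]: "geod y u 0 = y"
  by (simp add: geod_def)

lemma inner_geod:
  assumes "norm y = 1" "norm u = 1" "y \<bullet> u = 0"
  shows "geod y u s \<bullet> geod y u t = cos (s - t)"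
proof -
  have "y \<bullet> y = 1" "u \<bullet> u = 1" "u \<bullet> y = 0"
    using assms by (auto simp: norm_eq_1 inner_commute)
  then show ?thesis
    using assms(3) by (simp add: geod_def inner_add cos_diff)
qed

lemma norm_geod:
  assumes "norm y = 1" "norm u = 1" "y \<bullet> u = 0"
  shows "norm (geod y u t) = 1"
  using inner_geod[OF assms, of t t] by (simp add: norm_eq_1)

lemma ang_geod:
  assumes "norm y = 1" "norm u = 1" "y \<bullet> u = 0" "\<bar>s - t\<bar> \<le> pi"
  shows "ang (geod y u s) (geod y u t) = \<bar>s - t\<bar>"
  using assms by (simp add: ang_def inner_geod arccos_cos_eq_abs)

lemma geodesic_exists:
  fixes y y' :: "'a::euclidean_space"
  assumes "2 \<le> DIM('a)" and y: "norm y = 1" "norm y' = 1"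
  obtains u where "norm u = 1" "y \<bullet> u = 0" "geod y u (ang y y') = y'"
proof (cases "sin (ang y y') = 0")
  case True
  \<comment> \<open>Here \<open>y'\<close> is \<open>y\<close> or \<open>- y\<close>, and any
    orthogonal direction serves.\<close>
  obtain v where v: "v \<noteq> 0" "orthogonal y v"
    using orthogonal_to_vector_exists[OF assms(1)] by blast
  have "ang y y' = 0 \<or> ang y y' = pi"
    using True ang_bounds[OF y] sin_gt_zero[of "ang y y'"] by force
  then have "cos (ang y y') *\<^sub>R y = y'"
    using ang_eq_0_iff[OF y] ang_eq_pi_iff[OF y] by auto
  then have "geod y ((1 / norm v) *\<^sub>R v) (ang y y') = y'"
    using True by (simp add: geod_def)
  with v show ?thesis
    by (intro that[of "(1 / norm v) *\<^sub>R v"]) (auto simp: orthogonal_def)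
next
  case False
  let ?s = "sin (ang y y')"
  define u where "u = (1 / ?s) *\<^sub>R (y' - (y \<bullet> y') *\<^sub>R y)"
  have yy: "y \<bullet> y = 1" "y' \<bullet> y' = 1"
    using y by (auto simp: norm_eq_1)
  have "(y' - (y \<bullet> y') *\<^sub>R y) \<bullet> (y' - (y \<bullet> y') *\<^sub>R y) = ?s * ?s"
    using y by (simp add: sin_squared_eq[unfolded power2_eq_square] inner_diff inner_commute yy)
  then have "u \<bullet> u = 1"
    using False by (simp add: u_def)
  moreover have "y \<bullet> u = 0"
    by (simp add: u_def inner_diff yy)
  moreover have "geod y u (ang y y') = y'"
    using False y by (simp add: geod_def u_def)
  ultimately show ?thesis
    by (intro that[of u]) (auto simp: norm_eq_1)
qed

text \<open>Cut the geodesic from \<open>z\<close> to \<open>z'\<close> into \<open>Suc N\<close>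
  equal steps. The quadratic errors of the steps add up to only \<open>T\<^sup>2 / Suc N\<close>,
  which tends to 0.\<close>

lemma ang_le_of_locally_almost_nonexpanding:
  fixes h :: "'a::euclidean_space \<Rightarrow> 'a"
  assumes "2 \<le> DIM('a)"
    and h: "\<And>z. norm z = 1 \<Longrightarrow> norm (h z) = 1"
    and le: "\<And>z z'. norm z = 1 \<Longrightarrow> norm z' = 1 \<Longrightarrow> ang (h z) (h z') \<le> ang z z' + (ang z z')\<^sup>2"
    and z: "norm z = 1" "norm z' = 1"
  shows "ang (h z) (h z') \<le> ang z z'"
proof -
  define T where "T = ang z z'"
  have T: "0 \<le> T" "T \<le> pi"
    using ang_bounds[OF z] by (auto simp: T_def)
  obtain u where u: "norm u = 1" "z \<bullet> u = 0" "geod z u T = z'"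
    using geodesic_exists[OF assms(1) z] T_def by blast
  have "ang (h z) (h z') \<le> T + T\<^sup>2 / Suc N" for N
  proof -
    let ?\<delta> = "T / Suc N"
    let ?p = "\<lambda>i. geod z u (real i * ?\<delta>)"
    have unit: "norm (?p i) = 1" for i
      using norm_geod z u by blast
    have small: "?\<delta> \<le> pi" "0 \<le> ?\<delta>"
      using T by (auto simp: divide_le_eq intro: order_trans[of T pi] mult_left_mono)
    have step: "ang (?p i) (?p (Suc i)) = ?\<delta>" for i
    proof -
      have "real i * ?\<delta> - real (Suc i) * ?\<delta> = - ?\<delta>"
        by (simp only: left_diff_distrib[symmetric]) simp
      then show ?thesis
        using ang_geod[OF z(1) u(1,2), of "real i * ?\<delta>" "real (Suc i) * ?\<delta>"] small T by simp
    qed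
    have "ang (h z) (h (?p i)) \<le> real i * (?\<delta> + ?\<delta>\<^sup>2)" for i
    proof (induction i)
      case 0
      then show ?case using h z by simp
    next
      case (Suc i)
      have "ang (h z) (h (?p (Suc i))) \<le> ang (h z) (h (?p i)) + ang (h (?p i)) (h (?p (Suc i)))"
        by (intro ang_triangle h z unit)
      also have "\<dots> \<le> real i * (?\<delta> + ?\<delta>\<^sup>2) + (?\<delta> + ?\<delta>\<^sup>2)"
        using le[OF unit unit, of i "Suc i"] Suc by (simp only: step add_mono)
      also have "\<dots> = real (Suc i) * (?\<delta> + ?\<delta>\<^sup>2)"
        by (simp only: of_nat_Suc distrib_right) simp
      finally show ?case .
    qed
    from this[of "Suc N"] have "ang (h z) (h (?p (Suc N))) \<le> real (Suc N) * (?\<delta> + ?\<delta>\<^sup>2)" .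
    moreover have "?p (Suc N) = z'"
      using u(3) by simp
    moreover have "real (Suc N) * (?\<delta> + ?\<delta>\<^sup>2) = T + T\<^sup>2 / Suc N"
      by (simp only: distrib_left power2_eq_square) simp
    ultimately show ?thesis by simp
  qed
  moreover have "(\<lambda>N. T + T\<^sup>2 / Suc N) \<longlonglongrightarrow> T"
    using tendsto_add[OF tendsto_const[of T] LIMSEQ_Suc[OF lim_const_over_n[of "T\<^sup>2"]]] by simp
  ultimately show ?thesis
    unfolding T_def by (meson LIMSEQ_le_const)
qed

text \<open>Surjectivity lets us realise the antipode of \<open>h z\<close>, and only \<open>- z\<close> is far enough from \<open>z\<close> to be mapped there.\<close>

lemma nonexpanding_surjection_isometric:
  fixes h :: "'a::real_inner \<Rightarrow> 'a"
  assumes surj: "h ` sphere 0 1 = sphere 0 1"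
    and le: "\<And>z z'. norm z = 1 \<Longrightarrow> norm z' = 1 \<Longrightarrow> ang (h z) (h z') \<le> ang z z'"
    and z: "norm z = 1" "norm z' = 1"
  shows "ang (h z) (h z') = ang z z'"
proof -
  have h: "norm (h z) = 1" if "norm z = 1" for z
    using surj that by auto
  have "- h z' \<in> h ` sphere 0 1"
    using h z by (simp add: surj)
  then obtain w where w: "norm w = 1" "h w = - h z'"
    by auto
  have "pi = ang (h w) (h z')"
    using w h z by (simp add: ang_minus_left)
  also have "\<dots> \<le> ang w z'"
    using le w z by blast
  finally have "w = - z'"
    using ang_bounds ang_eq_pi_iff w z by (metis ang_commute order_antisym)
  then have "pi - ang (h z) (h z') \<le> pi - ang z z'"
    using le[of z w] w h z by (simp add: ang_minus_right)
  with le[OF z] show ?thesis by linarith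
qed

section \<open>Maps homotopic to a multiplication with unit\<close>

text \<open>A map missing \<open>a\<close> can be deformed to the constant \<open>- a\<close> by
  normalising straight segments. The identity would then be nullhomotopic, but spheres are not
  contractible.\<close>

lemma homotopic_to_id_sphere_surjective:
  fixes g :: "'a::euclidean_space \<Rightarrow> 'a"
  assumes "homotopic_with_canon (\<lambda>_. True) (sphere 0 1) (sphere 0 1) g id"
  shows "g ` sphere 0 1 = sphere 0 1"
proof (rule ccontr)
  let ?S = "sphere (0::'a) 1"
  have g: "continuous_on ?S g" "g ` ?S \<subseteq> ?S"
    using assms homotopic_with_imp_continuous homotopic_with_imp_subset1 by blast+
  assume "g ` ?S \<noteq> ?S"
  with g obtain a where "a \<in> ?S" and a: "a \<notin> g ` ?S"
    by blast
  then have na: "norm a = 1"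
    by simp
  have "homotopic_with_canon (\<lambda>_. True) ?S (- {0}) g (\<lambda>_. - a)"
  proof (rule homotopic_with_linear)
    fix x assume x: "x \<in> ?S"
    have gx: "norm (g x) = 1"
      using g x by (auto simp: image_subset_iff)
    have "0 \<notin> closed_segment (g x) (- a)"
    proof
      assume "0 \<in> closed_segment (g x) (- a)"
      then obtain u where u: "0 \<le> u" "u \<le> 1" and eq: "(1 - u) *\<^sub>R g x = u *\<^sub>R a"
        by (auto simp: in_segment)
      \<comment> \<open>Equal norms force the zero to be the midpoint of the segment, so that
        \<open>g x\<close> would be \<open>a\<close>.\<close>
      have "norm ((1 - u) *\<^sub>R g x) = norm (u *\<^sub>R a)"
        by (simp only: eq)
      then have "\<bar>1 - u\<bar> = \<bar>u\<bar>"
        by (simp only: norm_scaleR gx na mult_1_right)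
      with u have "u = 1 / 2" by linarith
      with eq have "g x = a" by simp
      with x a show False by blast
    qed
    then show "closed_segment (g x) (- a) \<subseteq> - {0}" by blast
  qed (use g in auto)
  then have "homotopic_with_canon (\<lambda>_. True) ?S ?S (sgn \<circ> g) (sgn \<circ> (\<lambda>_. - a))"
    by (rule homotopic_with_compose_continuous_left)
       (auto intro!: continuous_intros simp: norm_sgn)
  then have "homotopic_with_canon (\<lambda>_. True) ?S ?S g (\<lambda>_. - a)"
    by (rule homotopic_with_eq) (use g na in \<open>auto simp: sgn_div_norm image_subset_iff\<close>)
  then have "homotopic_with_canon (\<lambda>_. True) ?S ?S id (\<lambda>_. - a)"
    using assms homotopic_with_symD homotopic_with_trans by blast
  then show False
    using contractible_sphere[of "0::'a" 1] by (auto simp: contractible_def)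
qed

text \<open>An H-space multiplication \<open>m\<close> on the unit sphere with strict unit
  \<open>e\<close>, and a map \<open>f\<close> in its homotopy class. The dimension bound makes the
  sphere connected and supplies orthogonal directions.\<close>

locale homotopic_to_unital =
  fixes f m :: "'a::euclidean_space \<times> 'a \<Rightarrow> 'a" and e :: 'a
  assumes dim: "2 \<le> DIM('a)"
    and e: "norm e = 1"
    and hom: "homotopic_with_canon (\<lambda>_. True) (sphere 0 1 \<times> sphere 0 1) (sphere 0 1) f m"
    and right_unit: "norm x = 1 \<Longrightarrow> m (x, e) = x"
    and left_unit: "norm x = 1 \<Longrightarrow> m (e, x) = x"
begin

lemma norm_f: "norm x = 1 \<Longrightarrow> norm y = 1 \<Longrightarrow> norm (f (x, y)) = 1"
  using homotopic_with_imp_subset1[OF hom] by (auto simp: image_subset_iff)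

text \<open>Transfers every result about slices in the second variable to the first.\<close>

lemma swap: "homotopic_to_unital (\<lambda>p. f (prod.swap p)) (\<lambda>p. m (prod.swap p)) e"
proof
  show "homotopic_with_canon (\<lambda>_. True) (sphere 0 1 \<times> sphere 0 1) (sphere 0 1)
     (\<lambda>p. f (prod.swap p)) (\<lambda>p. m (prod.swap p))"
    using homotopic_with_compose_continuous_right[OF hom, of "sphere 0 1 \<times> sphere 0 1" prod.swap]
    by (force simp: o_def intro!: continuous_intros)
qed (use dim e right_unit left_unit in auto)

text \<open>The map \<open>q \<circ> r\<close> factors through an interval, hence is homotopic to
  the constant \<open>e\<close>. The map in question is therefore homotopic to
  \<open>\<lambda>x. m (x, e)\<close>, the identity.\<close>

lemma graph_surjective:
  assumes r: "continuous_on (sphere 0 1) r" "\<And>x. norm x = 1 \<Longrightarrow> r x \<in> {0..1::real}"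
    and q: "continuous_on {0..1} q" "\<And>t. t \<in> {0..1} \<Longrightarrow> norm (q t) = 1"
  shows "(\<lambda>x. f (x, q (r x))) ` sphere 0 1 = sphere 0 1"
proof (rule homotopic_to_id_sphere_surjective)
  let ?S = "sphere (0::'a) 1"
  obtain c where c: "homotopic_with_canon (\<lambda>_. True) ?S ?S (q \<circ> r) (\<lambda>_. c)"
    by (rule nullhomotopic_through_contractible[of ?S r "{0..1}" q ?S])
       (use r q in \<open>auto intro: convex_imp_contractible\<close>)
  then have "c \<in> ?S"
    using homotopic_with_imp_subset2[OF c] e by (auto simp: image_subset_iff)
  then have "path_component ?S c e"
    using path_connected_sphere_eq[of "0::'a" 1] dim e by (simp add: path_connected_component)
  then have "homotopic_with_canon (\<lambda>_. True) ?S ?S (\<lambda>_. c) (\<lambda>_. e)"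
    by (simp add: homotopic_constant_maps)
  with c have "homotopic_with_canon (\<lambda>_. True) ?S ?S (q \<circ> r) (\<lambda>_. e)"
    using homotopic_with_trans by blast
  moreover have "homotopic_with_canon (\<lambda>_. True) ?S ?S id id"
    by simp
  ultimately have "homotopic_with (\<lambda>_. True) (prod_topology (top_of_set ?S) (top_of_set ?S))
      (prod_topology (top_of_set ?S) (top_of_set ?S))
      (\<lambda>z. (id (fst z), (q \<circ> r) (snd z))) (\<lambda>z. (id (fst z), e))"
    using homotopic_with_prod_topology[of "\<lambda>_. True" _ _ id id "\<lambda>_. True" _ _ "q \<circ> r" "\<lambda>_. e" "\<lambda>_. True"]
    by blast
  then have "homotopic_with_canon (\<lambda>_. True) (?S \<times> ?S) (?S \<times> ?S)
      (\<lambda>z. (fst z, q (r (snd z)))) (\<lambda>z. (fst z, e))"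
    by (simp add: prod_topology_subtopology_eu)
  \<comment> \<open>Restriction to the diagonal feeds the same point to both components of the
    product homotopy.\<close>
  then have "homotopic_with_canon (\<lambda>_. True) ?S (?S \<times> ?S)
      ((\<lambda>z. (fst z, q (r (snd z)))) \<circ> (\<lambda>x. (x, x))) ((\<lambda>z. (fst z, e)) \<circ> (\<lambda>x. (x, x)))"
    by (rule homotopic_with_compose_continuous_right) (auto intro!: continuous_intros)
  from homotopic_compose[OF this hom]
  show "homotopic_with_canon (\<lambda>_. True) ?S ?S (\<lambda>x. f (x, q (r x))) id"
    by (rule homotopic_with_eq) (auto simp: right_unit)
qed

text \<open>This is the graph argument for the swapped map, with the constant path at
  \<open>x\<close>.\<close>

lemma slice_surjective:
  assumes "norm x = 1"
  shows "(\<lambda>y. f (x, y)) ` sphere 0 1 = sphere 0 1"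
proof -
  interpret s: homotopic_to_unital "\<lambda>p. f (prod.swap p)" "\<lambda>p. m (prod.swap p)" e
    by (rule swap)
  show ?thesis
    using s.graph_surjective[of "\<lambda>_. 0" "\<lambda>_. x"] assms by auto
qed

section \<open>The two-point estimate and the lower bound\<close>

definition lipschitz :: "real \<Rightarrow> bool" where
  "lipschitz L \<longleftrightarrow> 0 \<le> L \<and> (\<forall>x y x' y'. norm x = 1 \<longrightarrow> norm y = 1 \<longrightarrow> norm x' = 1 \<longrightarrow> norm y' = 1 \<longrightarrow>
     ang (f (x, y)) (f (x', y')) \<le> L * sqrt ((ang x x')\<^sup>2 + (ang y y')\<^sup>2))"

lemma lipschitzD:
  assumes "lipschitz L" "norm x = 1" "norm y = 1" "norm x' = 1" "norm y' = 1"
  shows "ang (f (x, y)) (f (x', y')) \<le> L * sqrt ((ang x x')\<^sup>2 + (ang y y')\<^sup>2)"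
  using assms by (simp add: lipschitz_def)

text \<open>Run \<open>p\<close> from \<open>x\<close> to \<open>- x\<close> along all meridians simultaneously while the second argument travels
  along a geodesic from \<open>y\<close> to \<open>y'\<close>. The resulting map is still homotopic to the identity, so it
  attains the antipode of \<open>f (x, y)\<close>.\<close>

lemma lipschitz_two_point:
  assumes L: "lipschitz L" and x: "norm x = 1" and y: "norm y = 1" "norm y' = 1"
  shows "2 * pi \<le> L * sqrt (pi\<^sup>2 + (ang y y')\<^sup>2) + ang (f (x, y)) (f (- x, y'))"
proof -
  define \<delta> where "\<delta> = ang y y'"
  have \<delta>: "0 \<le> \<delta>" "\<delta> \<le> pi"
    using ang_bounds[OF y] by (auto simp: \<delta>_def)
  obtain u where u: "norm u = 1" "y \<bullet> u = 0" "geod y u \<delta> = y'"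
    using geodesic_exists[OF dim y] \<delta>_def by blast
  define r where "r = (\<lambda>p. ang x p / pi)"
  define q where "q = (\<lambda>t. geod y u (t * \<delta>))"
  have r01: "0 \<le> r p" "r p \<le> 1" if "norm p = 1" for p
    using ang_bounds[OF x that] by (auto simp: r_def)
  have nq: "norm (q t) = 1" for t
    using norm_geod[OF y(1) u(1,2)] by (simp add: q_def)
  have "continuous_on (sphere 0 1) r"
    unfolding r_def ang_def
    by (intro continuous_intros) (use inner_unit_bounds[OF x] in auto)
  moreover have "continuous_on {0..1} q"
    unfolding q_def by (intro continuous_intros)
  ultimately have "(\<lambda>p. f (p, q (r p))) ` sphere 0 1 = sphere 0 1"
    using r01 nq by (intro graph_surjective) auto
  moreover have "norm (- f (x, y)) = 1"
    using norm_f x y by simp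
  ultimately obtain p where p: "norm p = 1" "f (p, q (r p)) = - f (x, y)"
    by (metis (mono_tags, lifting) imageE mem_sphere_0)
  \<comment> \<open>The point \<open>p\<close> sits at the same fraction \<open>r p\<close> of the
    meridian and of the geodesic. Its product distances to the two ends are thus
    \<open>r p * ?s\<close> and \<open>(1 - r p) * ?s\<close>, with sum \<open>?s\<close>.\<close>
  let ?s = "sqrt (pi\<^sup>2 + \<delta>\<^sup>2)"
  have scale: "sqrt ((c * pi)\<^sup>2 + (c * \<delta>)\<^sup>2) = c * ?s" if "0 \<le> c" for c
    using that by (simp add: power_mult_distrib real_sqrt_mult flip: distrib_left)
  have small: "r p * \<delta> \<le> pi" "(1 - r p) * \<delta> \<le> pi" "0 \<le> r p * \<delta>" "0 \<le> (1 - r p) * \<delta>"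
    using r01[OF p(1)] \<delta> mult_mono[of "r p" 1 \<delta> pi] mult_mono[of "1 - r p" 1 \<delta> pi] by auto
  have a1: "ang y (q (r p)) = r p * \<delta>"
    using ang_geod[OF y(1) u(1,2), of 0 "r p * \<delta>"] small by (simp add: q_def)
  have "\<bar>r p * \<delta> - \<delta>\<bar> = (1 - r p) * \<delta>"
    using small by (simp add: algebra_simps)
  then have a2: "ang (q (r p)) y' = (1 - r p) * \<delta>"
    using ang_geod[OF y(1) u(1,2), of "r p * \<delta>" \<delta>] small u by (simp add: q_def)
  have b1: "ang x p = r p * pi"
    by (simp add: r_def)
  have b2: "ang p (- x) = (1 - r p) * pi"
    using ang_minus_right[OF p(1) x] b1 by (simp add: ang_commute algebra_simps)
  have "pi = ang (f (x, y)) (f (p, q (r p)))"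
    using p norm_f x y by (simp add: ang_minus_right)
  also have "\<dots> \<le> L * sqrt ((ang x p)\<^sup>2 + (ang y (q (r p)))\<^sup>2)"
    using x y p nq by (intro lipschitzD[OF L])
  also have "\<dots> = L * (r p * ?s)"
    using r01 p by (simp only: a1 b1 scale)
  finally have 1: "pi \<le> L * (r p * ?s)" .
  have "pi - ang (f (x, y)) (f (- x, y')) = ang (f (p, q (r p))) (f (- x, y'))"
    using p norm_f x y by (simp add: ang_minus_left)
  also have "\<dots> \<le> L * sqrt ((ang p (- x))\<^sup>2 + (ang (q (r p)) y')\<^sup>2)"
    using x y p nq by (intro lipschitzD[OF L]) auto
  also have "\<dots> = L * ((1 - r p) * ?s)"
    using r01 p by (simp only: a2 b2 scale diff_ge_0_iff_ge)
  finally show ?thesis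
    using 1 by (simp add: algebra_simps \<delta>_def)
qed

text \<open>Choosing \<open>y\<close> with \<open>f (- e, y) = f (e, e)\<close> removes the last
  term of the two-point estimate. Since \<open>ang e y \<le> pi\<close>, what remains is
  \<open>2 * pi \<le> L * sqrt 2 * pi\<close>.\<close>

lemma lipschitz_ge_sqrt2:
  assumes L: "lipschitz L"
  shows "sqrt 2 \<le> L"
proof -
  have "f (e, e) \<in> (\<lambda>y. f (- e, y)) ` sphere 0 1"
    using slice_surjective[of "- e"] norm_f e by simp
  then obtain y where y: "norm y = 1" "f (- e, y) = f (e, e)"
    by auto
  have "2 * pi \<le> L * sqrt (pi\<^sup>2 + (ang e y)\<^sup>2)"
    using lipschitz_two_point[OF L e e y(1)] y norm_f e by simp
  also have "\<dots> \<le> L * sqrt (pi\<^sup>2 + pi\<^sup>2)"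
    using L ang_bounds[OF e y(1)]
    by (intro mult_left_mono real_sqrt_le_mono add_mono power_mono) (auto simp: lipschitz_def)
  also have "sqrt (pi\<^sup>2 + pi\<^sup>2) = sqrt 2 * pi"
    by (simp add: real_sqrt_mult flip: mult_2)
  finally have "2 \<le> L * sqrt 2"
    by simp
  then have "sqrt 2 * sqrt 2 \<le> L * sqrt 2"
    by simp
  then show ?thesis
    by (simp only: mult_le_cancel_right) auto
qed

section \<open>Rigidity at the extremal Lipschitz constant\<close>

context
  assumes lip: "lipschitz (sqrt 2)"
begin

lemma sqrt2_cancel: "sqrt 2 * sqrt (pi\<^sup>2 + t\<^sup>2) = sqrt (2 * (pi\<^sup>2 + t\<^sup>2))"
  by (simp only: real_sqrt_mult)

text \<open>Equality in the lower bound leaves no slack: the two-point estimate squares to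
  \<open>pi\<^sup>2 \<le> ?a\<^sup>2\<close>.\<close>

lemma antipodal_of_eq:
  assumes "norm x = 1" "norm y = 1" "norm y' = 1" "f (- x, y') = f (x, y)"
  shows "y' = - y"
proof -
  let ?a = "ang y y'"
  have "2 * pi \<le> sqrt (2 * (pi\<^sup>2 + ?a\<^sup>2))"
    using lipschitz_two_point[OF lip assms(1-3)] assms norm_f by (simp only: sqrt2_cancel) simp
  then have "(2 * pi)\<^sup>2 \<le> 2 * (pi\<^sup>2 + ?a\<^sup>2)"
    by (intro sqrt_ge_absD) simp
  then have "pi\<^sup>2 \<le> ?a\<^sup>2"
    by (simp add: power2_eq_square)
  then have "pi \<le> ?a"
    using ang_bounds assms by (meson power2_le_imp_le)
  then show ?thesis
    using ang_bounds ang_eq_pi_iff assms by (metis order_antisym)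
qed

text \<open>The slice at \<open>- x\<close> attains the value \<open>f (x, y)\<close> somewhere, and
  the preceding lemma allows only \<open>- y\<close>.\<close>

lemma f_minus_minus:
  assumes "norm x = 1" "norm y = 1"
  shows "f (- x, - y) = f (x, y)"
proof -
  have "f (x, y) \<in> (\<lambda>y. f (- x, y)) ` sphere 0 1"
    using slice_surjective[of "- x"] norm_f assms by simp
  then obtain y' where "norm y' = 1" "f (- x, y') = f (x, y)"
    by auto
  with antipodal_of_eq[OF assms this] show ?thesis by simp
qed

text \<open>The two-point estimate is applied to \<open>y\<close> and \<open>- y'\<close>, where the
  second value is \<open>f (- x, - y') = f (x, y')\<close> and the angle is
  \<open>pi - ?d\<close>.\<close>

lemma slice_nearly_expanding:
  assumes x: "norm x = 1" and y: "norm y = 1" "norm y' = 1"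
  defines "\<theta> \<equiv> ang (f (x, y)) (f (x, y'))"
  shows "ang y y' \<le> \<theta> + \<theta>\<^sup>2"
proof -
  let ?d = "ang y y'"
  have d: "0 \<le> ?d" "?d \<le> pi" and \<theta>: "0 \<le> \<theta>" "\<theta> \<le> pi"
    unfolding \<theta>_def by (intro ang_bounds norm_f x y)+
  have "2 * pi \<le> sqrt (2 * (pi\<^sup>2 + (pi - ?d)\<^sup>2)) + \<theta>"
    using lipschitz_two_point[OF lip x y(1), of "- y'"] f_minus_minus[OF x y(2)] y
    by (simp add: sqrt2_cancel ang_minus_right \<theta>_def)
  then have "2 * pi - \<theta> \<le> sqrt (2 * (pi\<^sup>2 + (pi - ?d)\<^sup>2))"
    by linarith
  moreover have "0 \<le> 2 * pi - \<theta>"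
    using \<theta> by linarith
  ultimately have "(2 * pi - \<theta>)\<^sup>2 \<le> 2 * (pi\<^sup>2 + (pi - ?d)\<^sup>2)"
    by (intro sqrt_ge_absD) simp
  then have *: "2 * pi * (2 * ?d) \<le> 2 * ?d\<^sup>2 + 2 * pi * (2 * \<theta>) - \<theta>\<^sup>2"
    by (simp add: power2_eq_square algebra_simps)
  \<comment> \<open>Bootstrapping: the crude bound \<open>?d\<^sup>2 \<le> pi * ?d\<close> first
    yields \<open>?d \<le> 2 * \<theta>\<close>. Put back into \<open>*\<close>, this turns the
    quadratic term into a multiple of \<open>\<theta>\<^sup>2\<close>.\<close>
  have "?d * ?d \<le> pi * ?d"
    using d by (simp add: mult_right_mono)
  then have "pi * ?d \<le> pi * (2 * \<theta>)"
    using * zero_le_square[of \<theta>] unfolding power2_eq_square by linarith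
  then have half: "?d \<le> 2 * \<theta>"
    by simp
  then have "?d * ?d \<le> (2 * \<theta>) * (2 * \<theta>)"
    using d by (intro mult_mono) auto
  then have "2 * pi * (2 * ?d) \<le> 8 * \<theta>\<^sup>2 + 2 * pi * (2 * \<theta>)"
    using * zero_le_square[of \<theta>] unfolding power2_eq_square by linarith
  also have "\<dots> \<le> 2 * pi * (2 * \<theta>\<^sup>2) + 2 * pi * (2 * \<theta>)"
    using mult_right_mono[OF pi_ge_two, of "4 * \<theta>\<^sup>2"] by simp
  also have "\<dots> = 2 * pi * (2 * (\<theta> + \<theta>\<^sup>2))"
    by (simp add: algebra_simps)
  finally show ?thesis
    by simp
qed

text \<open>The inverse \<open>h\<close> of the slice is nonexpanding up to a quadratic error, hence
  nonexpanding. Being onto, it is an isometry, and so is the slice.\<close>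

lemma slice_isometric:
  assumes x: "norm x = 1" and y: "norm y = 1" "norm y' = 1"
  shows "ang (f (x, y)) (f (x, y')) = ang y y'"
proof -
  let ?S = "sphere (0::'a) 1"
  have inj: "inj_on (\<lambda>y. f (x, y)) ?S"
  proof (rule inj_onI)
    fix y y' assume yy: "y \<in> ?S" "y' \<in> ?S" "f (x, y) = f (x, y')"
    then have "ang y y' \<le> 0"
      using slice_nearly_expanding[OF x, of y y'] norm_f[OF x, of y'] by simp
    then show "y = y'"
      using yy ang_bounds(1)[of y y'] ang_eq_0_iff[of y y'] by simp
  qed
  define h where "h = inv_into ?S (\<lambda>y. f (x, y))"
  have h: "norm (h z) = 1" "f (x, h z) = z" if "norm z = 1" for z
    using that slice_surjective[OF x] inv_into_into[of z "\<lambda>y. f (x, y)" ?S]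
      f_inv_into_f[of z "\<lambda>y. f (x, y)" ?S] by (auto simp: h_def)
  have hf: "h (f (x, y)) = y" if "norm y = 1" for y
    using that inv_into_f_f[OF inj, of y] by (simp add: h_def)
  have "ang (h z) (h z') \<le> ang z z' + (ang z z')\<^sup>2" if "norm z = 1" "norm z' = 1" for z z'
    using slice_nearly_expanding[OF x, of "h z" "h z'"] h that by simp
  then have le: "ang (h z) (h z') \<le> ang z z'" if "norm z = 1" "norm z' = 1" for z z'
    using that h by (intro ang_le_of_locally_almost_nonexpanding[OF dim]) auto
  have "h ` ?S = ?S"
  proof
    show "?S \<subseteq> h ` ?S"
      using hf norm_f x by (metis image_eqI mem_sphere_0 subsetI)
  qed (use h in auto)
  then have "ang (h (f (x, y))) (h (f (x, y'))) = ang (f (x, y)) (f (x, y'))"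
    using le norm_f x y by (intro nonexpanding_surjection_isometric) auto
  then show ?thesis
    using hf y by simp
qed

text \<open>On unit vectors angles determine inner products and hence chordal distances, and
  distance-preserving maps of the sphere extend linearly.\<close>

lemma slice_orthogonal:
  assumes x: "norm x = 1"
  obtains g where "orthogonal_transformation g" "\<And>y. norm y = 1 \<Longrightarrow> g y = f (x, y)"
proof -
  have inner: "f (x, y) \<bullet> f (x, y') = y \<bullet> y'" if "norm y = 1" "norm y' = 1" for y y'
    using slice_isometric[OF x that] cos_ang[OF that] cos_ang norm_f x that by metis
  have "dist (f (x, y)) (f (x, y')) = dist y y'" if "norm y = 1" "norm y' = 1" for y y'
    using inner[OF that] inner[OF that(1) that(1)] inner[OF that(2) that(2)]
    by (simp add: dist_norm norm_eq inner_diff inner_commute)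
  then show ?thesis
    using isometry_sphere_extend[of "\<lambda>y. f (x, y)"] norm_f x that by blast
qed

end

text \<open>Extending with degree one in each variable turns the two families of slice isometries
  into a single normed bilinear multiplication.\<close>

theorem bilinear_extension:
  assumes lip: "lipschitz (sqrt 2)"
  obtains B where "bilinear B" "\<And>x y. norm (B x y) = norm x * norm y"
    "\<And>x y. norm x = 1 \<Longrightarrow> norm y = 1 \<Longrightarrow> f (x, y) = B x y"
proof -
  interpret s: homotopic_to_unital "\<lambda>p. f (prod.swap p)" "\<lambda>p. m (prod.swap p)" e
    by (rule swap)
  have slip: "s.lipschitz (sqrt 2)"
    unfolding s.lipschitz_def
  proof (intro conjI allI impI)
    fix x y x' y' :: 'a assume "norm x = 1" "norm y = 1" "norm x' = 1" "norm y' = 1"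
    then show "ang (f (prod.swap (x, y))) (f (prod.swap (x', y'))) \<le> sqrt 2 * sqrt ((ang x x')\<^sup>2 + (ang y y')\<^sup>2)"
      using lipschitzD[OF lip, of y x y' x'] by (simp add: add.commute)
  qed simp
  \<comment> \<open>As \<open>sgn 0 = 0\<close> lies off the sphere, the factor in front makes
    \<open>B\<close> vanish there, whatever \<open>f\<close> does.\<close>
  define B where "B = (\<lambda>x y. (norm x * norm y) *\<^sub>R f (sgn x, sgn y))"
  have right: "linear (B x)" for x
  proof (cases "x = 0")
    case True
    then show ?thesis by (auto simp: B_def intro!: linearI)
  next
    case False
    then obtain g where g: "orthogonal_transformation g" "\<And>y. norm y = 1 \<Longrightarrow> g y = f (sgn x, y)"
      using slice_orthogonal[OF lip, of "sgn x"] by (auto simp: norm_sgn)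
    have lin: "linear g"
      using g orthogonal_transformation_linear by blast
    have "B x y = norm x *\<^sub>R g y" for y
    proof (cases "y = 0")
      case True
      then show ?thesis using linear_0[OF lin] by (simp add: B_def)
    next
      case False
      then have "f (sgn x, sgn y) = g (sgn y)"
        using g by (simp add: norm_sgn)
      then show ?thesis
        using False by (simp add: B_def sgn_div_norm linear_scale[OF lin])
    qed
    then have "B x = (\<lambda>y. norm x *\<^sub>R g y)" by blast
    then show ?thesis
      using lin by (simp add: linear_compose_scale_right)
  qed
  have left: "linear (\<lambda>x. B x y)" for y
  proof (cases "y = 0")
    case True
    then show ?thesis by (auto simp: B_def intro!: linearI)
  next
    case False
    then obtain g where g: "orthogonal_transformation g" "\<And>x. norm x = 1 \<Longrightarrow> g x = f (x, sgn y)"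
      using s.slice_orthogonal[OF slip, of "sgn y"] by (auto simp: norm_sgn)
    have lin: "linear g"
      using g orthogonal_transformation_linear by blast
    have "B x y = norm y *\<^sub>R g x" for x
    proof (cases "x = 0")
      case True
      then show ?thesis using linear_0[OF lin] by (simp add: B_def)
    next
      case False
      then have "f (sgn x, sgn y) = g (sgn x)"
        using g by (simp add: norm_sgn)
      then show ?thesis
        using False by (simp add: B_def sgn_div_norm linear_scale[OF lin])
    qed
    then have "(\<lambda>x. B x y) = (\<lambda>x. norm y *\<^sub>R g x)" by blast
    then show ?thesis
      using lin by (simp add: linear_compose_scale_right)
  qed
  show ?thesis
  proof
    show "bilinear B"
      using left right by (simp add: bilinear_def)
    show "norm (B x y) = norm x * norm y" for x y
    proof (cases "x = 0 \<or> y = 0")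
      case True
      then show ?thesis by (auto simp: B_def)
    next
      case False
      then have "norm (f (sgn x, sgn y)) = 1"
        by (intro norm_f) (auto simp: norm_sgn)
      then show ?thesis
        by (simp add: B_def)
    qed
    show "f (x, y) = B x y" if "norm x = 1" "norm y = 1" for x y
      using that by (simp add: B_def sgn_div_norm)
  qed
qed

end

section \<open>Cayley--Dickson doubling in a normed algebra\<close>

definition comb :: "(nat \<Rightarrow> 'a::real_vector) \<Rightarrow> nat \<Rightarrow> (nat \<Rightarrow> real) \<Rightarrow> 'a" where
  "comb b N x = (\<Sum>j<N. x j *\<^sub>R b j)"

lemma comb_cong: "(\<And>j. j < N \<Longrightarrow> x j = y j) \<Longrightarrow> comb b N x = comb b N y"
  by (simp add: comb_def)

lemma comb_add: "comb b N (\<lambda>j. x j + y j) = comb b N x + comb b N y"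
  by (simp add: comb_def scaleR_left_distrib sum.distrib)

lemma comb_diff: "comb b N (\<lambda>j. x j - y j) = comb b N x - comb b N y"
  by (simp add: comb_def scaleR_left_diff_distrib sum_subtractf)

lemma comb_minus: "comb b N (\<lambda>j. - x j) = - comb b N x"
  by (simp add: comb_def sum_negf)

lemma comb_scale: "comb b N (\<lambda>j. c * x j) = c *\<^sub>R comb b N x"
  by (simp add: comb_def scaleR_sum_right)

lemma sum_lessThan_double:
  "(\<Sum>j<2 * h. g j) = (\<Sum>j<h. g j) + (\<Sum>j<h. g (j + h))" for h :: nat
  using sum.nat_group[of g 2 h] sum.atLeastLessThan_concat[of 0 h "2 * h" g] sum.shift_bounds_nat_ivl[of g 0 h h]
  by (simp add: atLeast0LessThan mult_2)

definition low :: "nat \<Rightarrow> (nat \<Rightarrow> real) \<Rightarrow> nat \<Rightarrow> real" where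
  "low h x = (\<lambda>i. if i < h then x i else 0)"

definition high :: "nat \<Rightarrow> (nat \<Rightarrow> real) \<Rightarrow> nat \<Rightarrow> real" where
  "high h x = (\<lambda>i. if i < h then x (i + h) else 0)"

lemma cd_mult_Suc:
  "cd_mult (Suc k) x y = (\<lambda>i.
     if i < 2^k then cd_mult k (low (2^k) x) (low (2^k) y) i - cd_mult k (cd_conj k (high (2^k) y)) (high (2^k) x) i
     else if i < 2 * 2^k then cd_mult k (high (2^k) y) (low (2^k) x) (i - 2^k)
       + cd_mult k (high (2^k) x) (cd_conj k (low (2^k) y)) (i - 2^k)
     else 0)"
  unfolding low_def high_def by (simp add: Let_def)

text \<open>A unital real composition algebra. Associativity is not assumed, so that octonions are
  covered.\<close>

locale normed_unital_mult =
  fixes mult :: "'a::euclidean_space \<Rightarrow> 'a \<Rightarrow> 'a" (infixl "\<star>" 70) and e :: 'a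
  assumes bil: "bilinear (\<star>)"
    and norm_mult: "norm (x \<star> y) = norm x * norm y"
    and unit_left [simp]: "e \<star> x = x"
    and unit_right [simp]: "x \<star> e = x"
    and norm_e: "norm e = 1"
begin

lemmas bil_simps = bilinear_ladd[OF bil] bilinear_radd[OF bil] bilinear_lsub[OF bil] bilinear_rsub[OF bil]
  bilinear_lmul[OF bil] bilinear_rmul[OF bil] bilinear_lneg[OF bil] bilinear_rneg[OF bil]

section \<open>Polarised norm identities, conjugation and the alternative laws\<close>

lemma inner_self_mult: "(x \<star> y) \<bullet> (x \<star> y) = (x \<bullet> x) * (y \<bullet> y)"
  by (simp add: dot_square_norm norm_mult power_mult_distrib)

lemma inner_mult_left: "(x \<star> a) \<bullet> (x \<star> b) = (x \<bullet> x) * (a \<bullet> b)"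
  using inner_self_mult[of x "a + b"] inner_self_mult[of x a] inner_self_mult[of x b]
  by (simp add: bil_simps inner_add inner_commute algebra_simps)

lemma inner_mult_right: "(a \<star> x) \<bullet> (b \<star> x) = (a \<bullet> b) * (x \<bullet> x)"
  using inner_self_mult[of "a + b" x] inner_self_mult[of a x] inner_self_mult[of b x]
  by (simp add: bil_simps inner_add inner_commute algebra_simps)

text \<open>Polarises multiplicativity of the norm in both factors. Setting one argument to
  \<open>e\<close> gives the adjoint rules below.\<close>

lemma inner_exchange: "(x \<star> a) \<bullet> (y \<star> b) + (y \<star> a) \<bullet> (x \<star> b) = 2 * (x \<bullet> y) * (a \<bullet> b)"
  using inner_mult_left[of "x + y" a b] inner_mult_left[of x a b] inner_mult_left[of y a b]
  by (simp add: bil_simps inner_add inner_commute algebra_simps)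

text \<open>The reflection that fixes \<open>e\<close> and negates its orthogonal
  complement.\<close>

definition mconj :: "'a \<Rightarrow> 'a" where
  "mconj x = (2 * (x \<bullet> e)) *\<^sub>R e - x"

lemma ee: "e \<bullet> e = 1"
  using norm_e by (simp add: norm_eq_1)

lemma mconj_conj [simp]: "mconj (mconj x) = x"
  by (simp add: mconj_def inner_diff ee algebra_simps)

lemma mconj_e [simp]: "mconj e = e"
  by (simp add: mconj_def ee scaleR_2)

lemma mconj_add: "mconj (x + y) = mconj x + mconj y"
  by (simp add: mconj_def inner_add algebra_simps)

lemma mconj_orth: "x \<bullet> e = 0 \<Longrightarrow> mconj x = - x"
  by (simp add: mconj_def)

lemma adjoint_left: "(x \<star> a) \<bullet> b = a \<bullet> (mconj x \<star> b)"
  using inner_exchange[of x a e b]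
  by (simp add: mconj_def bil_simps inner_diff algebra_simps)

lemma adjoint_right: "(a \<star> x) \<bullet> b = a \<bullet> (b \<star> mconj x)"
  using inner_exchange[of a x b e]
  by (simp add: mconj_def bil_simps inner_diff inner_commute algebra_simps)

lemma eq_by_inner: "(\<And>t. x \<bullet> t = y \<bullet> t) \<Longrightarrow> x = (y::'a)"
  using vector_eq_rdot by blast

text \<open>Moving factors across the inner product by the adjoint rules gives both sides the same
  product with every \<open>t\<close>.\<close>

lemma mconj_mult: "mconj (x \<star> y) = mconj y \<star> mconj x"
proof (rule eq_by_inner)
  fix t
  have "mconj (x \<star> y) \<bullet> t = (x \<star> y \<star> t) \<bullet> e"
    using adjoint_left[of "x \<star> y" t e] by (simp add: inner_commute)
  also have "\<dots> = y \<bullet> (mconj x \<star> mconj t)"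
    by (simp add: adjoint_right[of _ t e] adjoint_left[of x y])
  also have "\<dots> = (mconj y \<star> mconj x) \<bullet> t"
    using adjoint_right[of y t "mconj x"] adjoint_left[of y t "mconj x"] by (simp add: inner_commute)
  finally show "mconj (x \<star> y) \<bullet> t = (mconj y \<star> mconj x) \<bullet> t" .
qed

text \<open>The exchange identity with its outer factors moved across by adjointness. For orthogonal
  \<open>x\<close>, \<open>y\<close> it swaps them up to sign, a substitute for
  associativity.\<close>

lemma alternative_left: "mconj x \<star> (y \<star> a) + mconj y \<star> (x \<star> a) = (2 * (x \<bullet> y)) *\<^sub>R a"
proof (rule eq_by_inner)
  fix t
  show "(mconj x \<star> (y \<star> a) + mconj y \<star> (x \<star> a)) \<bullet> t = ((2 * (x \<bullet> y)) *\<^sub>R a) \<bullet> t"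
    using inner_exchange[of x a y t]
    by (simp add: inner_add adjoint_left[of "mconj x"] adjoint_left[of "mconj y"])
qed

lemma alternative_right: "x \<star> a \<star> mconj b + x \<star> b \<star> mconj a = (2 * (a \<bullet> b)) *\<^sub>R x"
proof (rule eq_by_inner)
  fix t
  show "(x \<star> a \<star> mconj b + x \<star> b \<star> mconj a) \<bullet> t = ((2 * (a \<bullet> b)) *\<^sub>R x) \<bullet> t"
    using inner_exchange[of x a t b] adjoint_right[of "x \<star> a" "mconj b" t] adjoint_right[of "x \<star> b" "mconj a" t]
    by (simp add: inner_add_left inner_commute[of "t \<star> a"])
qed

section \<open>Doubling a subalgebra \<open>H\<close> by a unit vector orthogonal to it\<close>

context
  fixes H :: "'a set" and i :: 'a
  assumes e_in: "e \<in> H"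
    and mult_in: "a \<in> H \<Longrightarrow> b \<in> H \<Longrightarrow> a \<star> b \<in> H"
    and conj_in: "a \<in> H \<Longrightarrow> mconj a \<in> H"
    and orth: "a \<in> H \<Longrightarrow> a \<bullet> i = 0"
    and norm_i: "norm i = 1"
begin

lemma mconj_i: "mconj i = - i"
  using orth[OF e_in] by (simp add: mconj_orth inner_commute)

text \<open>Adjointness moves \<open>b\<close> to the other side, where
  \<open>mconj b \<star> a\<close> stays in \<open>H\<close>.\<close>

lemma orth_mult_i: "a \<in> H \<Longrightarrow> b \<in> H \<Longrightarrow> a \<bullet> (b \<star> i) = 0"
  using orth[OF mult_in[OF conj_in, of b a]] adjoint_left[of b i a] by (simp add: inner_commute)

lemma mconj_mult_i: "b \<in> H \<Longrightarrow> mconj (b \<star> i) = - (b \<star> i)"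
  using orth_mult_i[OF e_in, of b] by (simp add: mconj_orth inner_commute)

text \<open>Compare the two values of \<open>mconj (b \<star> i)\<close>: it is imaginary, and
  conjugation reverses products.\<close>

lemma mult_i_commute: "b \<in> H \<Longrightarrow> b \<star> i = i \<star> mconj b"
  using mconj_mult_i[of b] mconj_mult[of b i] by (simp add: mconj_i bil_simps)

text \<open>Since \<open>mconj a\<close> is orthogonal to \<open>i\<close>, the left alternative law
  swaps them up to sign; \<open>mult_i_commute\<close> moves \<open>i\<close> back to the
  right.\<close>

lemma doubling_left:
  assumes "a \<in> H" "d \<in> H"
  shows "a \<star> (d \<star> i) = d \<star> a \<star> i"
proof -
  have "a \<star> (i \<star> mconj d) + mconj i \<star> (mconj a \<star> mconj d) = 0"
    using alternative_left[of "mconj a" i "mconj d"] orth[OF conj_in[OF assms(1)]] by simp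
  then have "a \<star> (i \<star> mconj d) = i \<star> mconj (d \<star> a)"
    by (simp add: mconj_i bil_simps mconj_mult)
  then show ?thesis
    using mult_i_commute[OF assms(2)] mult_i_commute[OF mult_in[OF assms(2,1)]] by simp
qed

lemma doubling_right:
  assumes "b \<in> H" "c \<in> H"
  shows "b \<star> i \<star> c = b \<star> mconj c \<star> i"
  using alternative_right[of b i "mconj c"] orth[OF conj_in[OF assms(2)]]
  by (simp add: mconj_i bil_simps inner_commute)

text \<open>The right alternative law for \<open>i\<close> and \<open>d \<star> i\<close>
  contributes \<open>2 * (d \<bullet> e)\<close>, which combines with \<open>d\<close> into
  \<open>mconj d\<close>.\<close>

lemma doubling_both:
  assumes "b \<in> H" "d \<in> H"
  shows "b \<star> i \<star> (d \<star> i) = - (mconj d \<star> b)"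
proof -
  have ii: "i \<bullet> i = 1"
    using norm_i by (simp add: norm_eq_1)
  have "i \<bullet> (d \<star> i) = d \<bullet> e"
    using inner_mult_right[of e i d] ii by (simp add: inner_commute)
  then have "- (b \<star> i \<star> (d \<star> i) + d \<star> b \<star> i \<star> i) = (2 * (d \<bullet> e)) *\<^sub>R b"
    using alternative_right[of b i "d \<star> i"] mconj_mult_i[OF assms(2)] doubling_left[OF assms]
    by (simp add: mconj_i bil_simps)
  then have "b \<star> i \<star> (d \<star> i) + d \<star> b \<star> i \<star> i = - ((2 * (d \<bullet> e)) *\<^sub>R b)"
    by (metis minus_minus)
  \<comment> \<open>The right alternative law with both arguments \<open>i\<close>: multiplying
    twice by \<open>i\<close> negates.\<close>
  moreover have "d \<star> b \<star> i \<star> i = - (d \<star> b)"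
  proof -
    have "2 *\<^sub>R (- (d \<star> b \<star> i \<star> i)) = 2 *\<^sub>R (d \<star> b)"
      using alternative_right[of "d \<star> b" i i] ii
      unfolding scaleR_2[of "- (d \<star> b \<star> i \<star> i)"] by (simp add: mconj_i bil_simps)
    then have "- (d \<star> b \<star> i \<star> i) = d \<star> b"
      unfolding real_vector.scale_cancel_left by simp
    then show ?thesis
      by (metis minus_minus)
  qed
  ultimately show ?thesis
    by (simp add: mconj_def bil_simps algebra_simps)
qed

lemma doubling:
  assumes "a \<in> H" "b \<in> H" "c \<in> H" "d \<in> H"
  shows "(a + b \<star> i) \<star> (c + d \<star> i) = (a \<star> c - mconj d \<star> b) + (d \<star> a + b \<star> mconj c) \<star> i"
  using assms by (simp add: bil_simps doubling_left doubling_right doubling_both)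

end

text \<open>The vectors \<open>b j\<close> are the images of the standard basis under an isometric
  homomorphism. Conjugation is included because the doubling formula involves it, so the induction
  must carry it along.\<close>

definition cd_embedding :: "nat \<Rightarrow> (nat \<Rightarrow> 'a) \<Rightarrow> bool" where
  "cd_embedding k b \<longleftrightarrow> b 0 = e \<and>
     (\<forall>x y. comb b (2^k) x \<bullet> comb b (2^k) y = (\<Sum>j<2^k. x j * y j)) \<and>
     (\<forall>x y. comb b (2^k) (cd_mult k x y) = comb b (2^k) x \<star> comb b (2^k) y) \<and>
     (\<forall>x. comb b (2^k) (cd_conj k x) = mconj (comb b (2^k) x))"

lemma cd_embedding_0: "cd_embedding 0 (\<lambda>_. e)"
  by (simp add: cd_embedding_def comb_def ee bil_simps cd_conj_def mconj_def flip: scaleR_left_diff_distrib)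

text \<open>The image \<open>H\<close> does not fill the space, so a unit vector \<open>i\<close>
  orthogonal to it exists, and the next algebra is realised on \<open>H\<close> plus
  \<open>H\<close> times \<open>i\<close>.\<close>

lemma cd_embedding_Suc:
  assumes emb: "cd_embedding k b" and less: "2 ^ k < DIM('a)"
  obtains b' where "cd_embedding (Suc k) b'"
proof -
  define h :: nat where "h = 2 ^ k"
  define H where "H = range (comb b h)"
  have h: "0 < h" by (simp add: h_def)
  have b0: "b 0 = e"
    and inner: "comb b h x \<bullet> comb b h y = (\<Sum>j<h. x j * y j)"
    and mult: "comb b h (cd_mult k x y) = comb b h x \<star> comb b h y"
    and mconj: "comb b h (cd_conj k x) = mconj (comb b h x)" for x y
    using emb by (auto simp: cd_embedding_def h_def)
  have "dim (b ` {..<h}) < DIM('a)"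
    using less dim_le_card'[of "b ` {..<h}"] card_image_le[of "{..<h}" b] by (simp add: h_def)
  then obtain v where v: "v \<noteq> 0" "\<And>y. y \<in> span (b ` {..<h}) \<Longrightarrow> orthogonal v y"
    using orthogonal_to_subspace_exists by blast
  define i where "i = sgn v"
  have i: "norm i = 1"
    using v by (simp add: i_def norm_sgn)
  have "comb b h x \<in> span (b ` {..<h})" for x
    unfolding comb_def by (intro span_sum span_scale span_base) auto
  then have orth: "a \<bullet> i = 0" if "a \<in> H" for a
    using that v(2) by (auto simp: H_def i_def sgn_div_norm orthogonal_def inner_commute)
  have e_in: "e \<in> H"
  proof -
    have "comb b h (\<lambda>j. if j = 0 then 1 else 0) = (\<Sum>j<h. if j = 0 then b j else 0)"
      unfolding comb_def by (intro sum.cong) auto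
    also have "\<dots> = e"
      using h b0 by simp
    finally show ?thesis
      unfolding H_def by (metis rangeI)
  qed
  have mult_in: "a \<star> c \<in> H" if "a \<in> H" "c \<in> H" for a c
    using that mult by (auto simp: H_def simp flip: mult)
  have conj_in: "mconj a \<in> H" if "a \<in> H" for a
    using that by (auto simp: H_def simp flip: mconj)
  note ctx = e_in mult_in conj_in orth i
  define b' where "b' j = (if j < h then b j else b (j - h) \<star> i)" for j
  have h2: "2 ^ Suc k = 2 * h"
    by (simp add: h_def)
  have lin_i: "linear (\<lambda>x. x \<star> i)"
    using bil by (simp add: bilinear_def)
  have comb': "comb b' (2 * h) x = comb b h x + comb b h (\<lambda>j. x (j + h)) \<star> i" for x
  proof -
    have "(\<Sum>j<h. x (j + h) *\<^sub>R (b j \<star> i)) = comb b h (\<lambda>j. x (j + h)) \<star> i"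
      by (simp add: comb_def linear_sum[OF lin_i] bil_simps)
    then show ?thesis
      by (simp add: comb_def sum_lessThan_double b'_def)
  qed
  have in_H: "comb b h x \<in> H" for x
    by (simp add: H_def)
  have "cd_embedding (Suc k) b'"
    unfolding cd_embedding_def h2
  proof (intro conjI allI)
    show "b' 0 = e"
      using h b0 by (simp add: b'_def)
  next
    fix x y
    show "comb b' (2 * h) x \<bullet> comb b' (2 * h) y = (\<Sum>j<2 * h. x j * y j)"
      using i orth_mult_i[OF ctx in_H in_H]
      by (simp add: comb' inner_add inner_mult_right inner sum_lessThan_double norm_eq_1 inner_commute)
  next
    fix x
    have "comb b h (cd_conj (Suc k) x) = comb b h (cd_conj k x)"
      using h by (intro comb_cong) (auto simp: cd_conj_def h_def)
    moreover have "comb b h (\<lambda>j. cd_conj (Suc k) x (j + h)) = comb b h (\<lambda>j. - x (j + h))"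
      using h by (intro comb_cong) (auto simp: cd_conj_def h_def)
    ultimately show "comb b' (2 * h) (cd_conj (Suc k) x) = mconj (comb b' (2 * h) x)"
      using mconj_mult_i[OF ctx in_H]
      by (simp add: comb' mconj mconj_add comb_minus bil_simps)
  next
    fix x y
    have low: "comb b h (low h x) = comb b h x"
      and high: "comb b h (high h x) = comb b h (\<lambda>j. x (j + h))" for x
      by (auto intro: comb_cong simp: low_def high_def)
    have "comb b h (cd_mult (Suc k) x y)
        = comb b h (\<lambda>j. cd_mult k (low h x) (low h y) j - cd_mult k (cd_conj k (high h y)) (high h x) j)"
      by (intro comb_cong) (simp add: cd_mult_Suc h_def del: cd_mult.simps)
    moreover have "comb b h (\<lambda>j. cd_mult (Suc k) x y (j + h))
        = comb b h (\<lambda>j. cd_mult k (high h y) (low h x) j + cd_mult k (high h x) (cd_conj k (low h y)) j)"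
      by (intro comb_cong) (simp add: cd_mult_Suc h_def del: cd_mult.simps)
    ultimately show "comb b' (2 * h) (cd_mult (Suc k) x y) = comb b' (2 * h) x \<star> comb b' (2 * h) y"
      by (simp add: comb' doubling[OF ctx in_H in_H in_H in_H] comb_diff comb_add mult mconj low high)
  qed
  then show ?thesis ..
qed

theorem cd_embedding_exists:
  assumes "2 ^ k \<le> DIM('a)"
  obtains b where "cd_embedding k b"
proof -
  have "\<exists>b. cd_embedding k b"
    using assms
  proof (induction k)
    case 0
    then show ?case using cd_embedding_0 by blast
  next
    case (Suc k)
    moreover have "(2::nat) ^ k < 2 ^ Suc k" by simp
    ultimately show ?case
      using cd_embedding_Suc by (metis less_le_trans less_imp_le)
  qed
  with that show ?thesis by blast
qed

end

subsection \<open>Bilinearity of the coordinate multiplication\<close>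

lemma low_add: "low h (\<lambda>i. x i + y i) = (\<lambda>i. low h x i + low h y i)"
  and high_add: "high h (\<lambda>i. x i + y i) = (\<lambda>i. high h x i + high h y i)"
  and low_scale: "low h (\<lambda>i. c * x i) = (\<lambda>i. c * low h x i)"
  and high_scale: "high h (\<lambda>i. c * x i) = (\<lambda>i. c * high h x i)"
  by (auto simp: low_def high_def)

lemma cd_conj_add: "cd_conj k (\<lambda>i. x i + y i) = (\<lambda>i. cd_conj k x i + cd_conj k y i)"
  and cd_conj_scale: "cd_conj k (\<lambda>i. c * x i) = (\<lambda>i. c * cd_conj k x i)"
  by (auto simp: cd_conj_def)

lemma cd_mult_add_left: "cd_mult k (\<lambda>i. x i + y i) z = (\<lambda>i. cd_mult k x z i + cd_mult k y z i)"
  and cd_mult_add_right: "cd_mult k z (\<lambda>i. x i + y i) = (\<lambda>i. cd_mult k z x i + cd_mult k z y i)"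
proof (induction k arbitrary: x y z)
  case 0
  { case 1 show ?case by (auto simp: algebra_simps) }
  { case 2 show ?case by (auto simp: algebra_simps) }
next
  case (Suc k)
  { case 1 show ?case by (rule ext) (simp add: cd_mult_Suc low_add high_add cd_conj_add Suc del: cd_mult.simps) }
  { case 2 show ?case by (rule ext) (simp add: cd_mult_Suc low_add high_add cd_conj_add Suc del: cd_mult.simps) }
qed

lemma cd_mult_scale_left: "cd_mult k (\<lambda>i. c * x i) z = (\<lambda>i. c * cd_mult k x z i)"
  and cd_mult_scale_right: "cd_mult k z (\<lambda>i. c * x i) = (\<lambda>i. c * cd_mult k z x i)"
proof (induction k arbitrary: x z)
  case 0
  { case 1 show ?case by auto }
  { case 2 show ?case by auto }
next
  case (Suc k)
  { case 1 show ?case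
      by (rule ext) (simp add: cd_mult_Suc low_scale high_scale cd_conj_scale Suc algebra_simps del: cd_mult.simps) }
  { case 2 show ?case
      by (rule ext) (simp add: cd_mult_Suc low_scale high_scale cd_conj_scale Suc algebra_simps del: cd_mult.simps) }
qed

definition cd_one :: "nat \<Rightarrow> real" where
  "cd_one = (\<lambda>i. if i = 0 then 1 else 0)"

lemma cd_one_simps: "low (2^k) cd_one = cd_one" "high (2^k) cd_one = (\<lambda>_. 0)" "cd_conj k cd_one = cd_one"
  by (auto simp: low_def high_def cd_conj_def cd_one_def)

lemma cd_mult_zero: "cd_mult k (\<lambda>_. 0) z = (\<lambda>_. 0)" "cd_mult k z (\<lambda>_. 0) = (\<lambda>_. 0)"
  using cd_mult_scale_left[of k 0 "\<lambda>_. 0" z] cd_mult_scale_right[of k z 0 "\<lambda>_. 0"] by simp_all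

text \<open>\<open>low\<close> appears because the product discards all coordinates from
  \<open>2^k\<close> on.\<close>

lemma cd_mult_one: "cd_mult k cd_one x = low (2^k) x" "cd_mult k x cd_one = low (2^k) x"
proof (induction k arbitrary: x)
  case 0
  { case 1 show ?case by (auto simp: low_def cd_one_def) }
  { case 2 show ?case by (auto simp: low_def cd_one_def) }
next
  case (Suc k)
  have conj0: "cd_conj k (\<lambda>_. 0) = (\<lambda>_. 0)"
    by (auto simp: cd_conj_def)
  { case 1 show ?case
      by (rule ext) (auto simp: cd_mult_Suc cd_one_simps cd_mult_zero conj0 Suc simp del: cd_mult.simps, auto simp: low_def high_def) }
  { case 2 show ?case
      by (rule ext) (auto simp: cd_mult_Suc cd_one_simps cd_mult_zero conj0 Suc simp del: cd_mult.simps, auto simp: low_def high_def) }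
qed

lemma cd_mult_support: "2 ^ k \<le> i \<Longrightarrow> cd_mult k x y i = 0"
  by (cases k) (auto simp: cd_mult_Suc simp del: cd_mult.simps(2))

section \<open>Transfer between coordinate functions and a Euclidean space\<close>

lemma mem_sphere_pts_Suc:
  "c \<in> sphere_pts n \<longleftrightarrow> low (Suc n) c = c \<and> (\<Sum>j<Suc n. c j * c j) = 1"
  by (force simp: sphere_pts_def low_def fun_eq_iff lessThan_Suc_atMost power2_eq_square)

text \<open>An enumeration of the standard basis links coordinate functions with a Euclidean space
  type, where the results on spheres and orthogonal maps live.\<close>

locale coordinates =
  fixes b :: "nat \<Rightarrow> 'a::euclidean_space" and n k :: nat
  assumes bij: "bij_betw b {..<Suc n} Basis"
    and n: "Suc n = 2 ^ k" "1 \<le> n"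
begin

abbreviation point :: "(nat \<Rightarrow> real) \<Rightarrow> 'a" where
  "point \<equiv> comb b (Suc n)"

definition coords :: "'a \<Rightarrow> nat \<Rightarrow> real" where
  "coords x = (\<lambda>j. if j < Suc n then x \<bullet> b j else 0)"

lemma dim: "DIM('a) = Suc n"
  using bij_betw_same_card[OF bij] by simp

lemma b_in_Basis: "j < Suc n \<Longrightarrow> b j \<in> Basis"
  using bij by (auto simp: bij_betw_def)

lemma inner_b:
  assumes "j < Suc n" "l < Suc n"
  shows "b j \<bullet> b l = (if j = l then 1 else 0)"
proof -
  have "b j = b l \<longleftrightarrow> j = l"
    using bij assms by (auto simp: bij_betw_def inj_on_eq_iff)
  then show ?thesis
    using inner_Basis[OF b_in_Basis[OF assms(1)] b_in_Basis[OF assms(2)]] by simp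
qed

lemma inner_point_b: "j < Suc n \<Longrightarrow> point c \<bullet> b j = c j"
  by (simp add: comb_def inner_sum_left inner_b if_distrib cong: if_cong del: sum.lessThan_Suc)

lemma coords_point: "coords (point c) = low (Suc n) c"
  by (auto simp: coords_def low_def inner_point_b)

lemma point_coords [simp]: "point (coords x) = x"
proof -
  have "point (coords x) = (\<Sum>j<Suc n. (x \<bullet> b j) *\<^sub>R b j)"
    unfolding comb_def coords_def by (intro sum.cong) auto
  also have "\<dots> = (\<Sum>v\<in>Basis. (x \<bullet> v) *\<^sub>R v)"
    by (rule sum.reindex_bij_betw[OF bij])
  also have "\<dots> = x"
    by (rule euclidean_representation)
  finally show ?thesis .
qed

lemma inner_point: "point c \<bullet> point d = (\<Sum>j<Suc n. c j * d j)"
  unfolding comb_def[of b _ d] inner_sum_right by (intro sum.cong) (auto simp: inner_point_b)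

lemma sum_coords: "(\<Sum>j<Suc n. coords x j * coords y j) = x \<bullet> y"
  by (simp only: inner_point[symmetric] point_coords)

lemma norm_point [simp]: "c \<in> sphere_pts n \<Longrightarrow> norm (point c) = 1"
  by (simp add: mem_sphere_pts_Suc norm_eq_1 inner_point del: sum.lessThan_Suc)

lemma coords_point_sphere [simp]: "c \<in> sphere_pts n \<Longrightarrow> coords (point c) = c"
  by (simp add: coords_point mem_sphere_pts_Suc)

lemma coords_in_sphere [simp]: "norm x = 1 \<Longrightarrow> coords x \<in> sphere_pts n"
  using coords_point[of "coords x"]
  by (simp add: mem_sphere_pts_Suc sum_coords norm_eq_1 del: sum.lessThan_Suc)

lemma sph_dist_eq_ang: "sph_dist n c d = ang (point c) (point d)"
  by (simp only: sph_dist_def ang_def inner_point lessThan_Suc_atMost)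

lemma sphprod_dist_eq_ang:
  "sphprod_dist n p q = sqrt ((ang (point (fst p)) (point (fst q)))\<^sup>2 + (ang (point (snd p)) (point (snd q)))\<^sup>2)"
  by (simp add: sphprod_dist_def sph_dist_eq_ang)

lemma continuous_on_point: "continuous_on A point"
  unfolding comb_def
  by (intro continuous_intros continuous_on_subset[OF continuous_on_product_coordinates]) auto

text \<open>Function spaces carry the product topology, so continuity is checked
  coordinatewise.\<close>

lemma continuous_on_coords: "continuous_on A coords"
proof (rule continuous_on_coordinatewise_then_product)
  fix j
  show "continuous_on A (\<lambda>x. coords x j)"
    by (cases "j < Suc n") (auto simp: coords_def intro!: continuous_intros)
qed

lemma coords_add: "coords (x + y) = (\<lambda>j. coords x j + coords y j)"
  and coords_scale: "coords (c *\<^sub>R x) = (\<lambda>j. c * coords x j)"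
  by (auto simp: coords_def inner_add_left)

lemma isometry_of_sphere:
  assumes T: "orthogonal_transformation T"
  shows "isometry_of (sph_dist n) (sphere_pts n) (\<lambda>c. coords (T (point c)))"
  unfolding isometry_of_def
proof (intro conjI ballI)
  have norm_T: "norm (T x) = norm x" "norm (inv T x) = norm x" for x
    using T orthogonal_transformation_inv orthogonal_transformation_norm by blast+
  show "(\<lambda>c. coords (T (point c))) ` sphere_pts n = sphere_pts n"
  proof (intro equalityI subsetI)
    fix c assume c: "c \<in> sphere_pts n"
    have "T (inv T (point c)) = point c"
      using orthogonal_transformation_surj[OF T] by (rule surj_f_inv_f)
    then have "c = coords (T (point (coords (inv T (point c)))))"
      using c by simp
    then show "c \<in> (\<lambda>c. coords (T (point c))) ` sphere_pts n"
      by (rule image_eqI[of _ "\<lambda>c. coords (T (point c))"]) (simp add: c norm_T)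
  qed (use norm_T in auto)
  show "sph_dist n (coords (T (point c))) (coords (T (point d))) = sph_dist n c d" for c d
    by (simp add: sph_dist_eq_ang ang_orthogonal_transformation[OF T])
qed

lemma isometry_of_sphere_product:
  assumes P: "orthogonal_transformation P" and Q: "orthogonal_transformation Q"
  shows "isometry_of (sphprod_dist n) (sphere_pts n \<times> sphere_pts n)
    (\<lambda>p. (coords (P (point (fst p))), coords (Q (point (snd p)))))"
proof -
  let ?g = "\<lambda>T c. coords (T (point c))"
  have "(\<lambda>p. (?g P (fst p), ?g Q (snd p))) ` (sphere_pts n \<times> sphere_pts n)
      = (?g P ` sphere_pts n) \<times> (?g Q ` sphere_pts n)"
    by force
  then show ?thesis
    using isometry_of_sphere[OF P] isometry_of_sphere[OF Q]
    by (simp add: isometry_of_def sphprod_dist_def)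
qed

end

section \<open>The given map and the multiplication carried over to Euclidean space\<close>

locale sphere_map = coordinates +
  fixes f :: "(nat \<Rightarrow> real) \<times> (nat \<Rightarrow> real) \<Rightarrow> nat \<Rightarrow> real"
  assumes sph_mult: "sph_mult n p = cd_mult k (fst p) (snd p)"
    and hom: "homotopic_with_canon (\<lambda>_. True) (sphere_pts n \<times> sphere_pts n) (sphere_pts n) f (sph_mult n)"
begin

definition M :: "'a \<Rightarrow> 'a \<Rightarrow> 'a" where
  "M x y = point (cd_mult k (coords x) (coords y))"

definition F :: "'a \<times> 'a \<Rightarrow> 'a" where
  "F p = point (f (coords (fst p), coords (snd p)))"

lemma f_in: "p \<in> sphere_pts n \<times> sphere_pts n \<Longrightarrow> f p \<in> sphere_pts n"
  using homotopic_with_imp_subset1[OF hom] by blast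

lemma F_point: "p \<in> sphere_pts n \<times> sphere_pts n \<Longrightarrow> F (point (fst p), point (snd p)) = point (f p)"
  by (auto simp: F_def)

lemma coords_M: "coords (M x y) = cd_mult k (coords x) (coords y)"
  unfolding M_def coords_point by (auto simp: low_def fun_eq_iff cd_mult_support n)

lemma M_point:
  assumes "p \<in> sphere_pts n \<times> sphere_pts n"
  shows "M (point (fst p)) (point (snd p)) = point (sph_mult n p)"
  using assms by (auto simp: M_def sph_mult)

lemma homotopic_F_M:
  "homotopic_with_canon (\<lambda>_. True) (sphere 0 1 \<times> sphere 0 1) (sphere 0 1) F (\<lambda>p. M (fst p) (snd p))"
proof -
  let ?c = "\<lambda>p. (coords (fst p), coords (snd p))"
  have "homotopic_with_canon (\<lambda>_. True) (sphere 0 1 \<times> sphere 0 1) (sphere_pts n) (f \<circ> ?c) (sph_mult n \<circ> ?c)"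
    by (rule homotopic_with_compose_continuous_right[OF hom])
       (auto intro!: continuous_on_Pair continuous_on_compose2[OF continuous_on_coords] continuous_on_fst continuous_on_snd continuous_on_id)
  then have "homotopic_with_canon (\<lambda>_. True) (sphere 0 1 \<times> sphere 0 1) (sphere 0 1)
      (point \<circ> (f \<circ> ?c)) (point \<circ> (sph_mult n \<circ> ?c))"
    by (rule homotopic_with_compose_continuous_left) (auto intro: continuous_on_point)
  then show ?thesis
    unfolding F_def[abs_def] by (simp add: o_def M_def sph_mult)
qed

lemma coords_b0: "coords (b 0) = cd_one"
  by (auto simp: coords_def cd_one_def inner_b)

lemma M_unit: "M (b 0) x = x" "M x (b 0) = x"
proof -
  have "low (Suc n) (coords x) = coords x"
    using coords_point[of "coords x"] by (simp only: point_coords)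
  then show "M (b 0) x = x" "M x (b 0) = x"
    by (simp_all add: M_def coords_b0 cd_mult_one flip: n(1))
qed

lemma norm_b0: "norm (b 0) = 1"
  using b_in_Basis[of 0] by simp

sublocale unital: homotopic_to_unital F "\<lambda>p. M (fst p) (snd p)" "b 0"
  by standard (use dim n norm_b0 homotopic_F_M M_unit in auto)

lemma bilinear_M: "bilinear M"
  unfolding bilinear_def
  by (intro conjI allI linearI)
     (simp_all add: M_def coords_add coords_scale cd_mult_add_left cd_mult_add_right
       cd_mult_scale_left cd_mult_scale_right comb_add comb_scale)

text \<open>No computation with coordinates is made: the homotopy has \<open>sph_mult n\<close> as
  its end, so products of unit vectors are unit vectors, and bilinearity does the rest.\<close>

sublocale algebra: normed_unital_mult M "b 0"
proof
  show "norm (M x y) = norm x * norm y" for x y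
  proof (cases "x = 0 \<or> y = 0")
    case True
    then show ?thesis
      using bilinear_lzero[OF bilinear_M] bilinear_rzero[OF bilinear_M] by auto
  next
    case False
    then have "norm (M (sgn x) (sgn y)) = 1"
      using homotopic_with_imp_subset2[OF homotopic_F_M] by (force simp: norm_sgn)
    moreover have inv: "norm x * norm y * (inverse (norm y) * inverse (norm x)) = 1"
      using False by (simp add: field_simps)
    moreover have "M x y = (norm x * norm y) *\<^sub>R M (sgn x) (sgn y)"
      using False inv by (simp add: sgn_div_norm bilinear_lmul[OF bilinear_M] bilinear_rmul[OF bilinear_M])
    ultimately show ?thesis by simp
  qed
qed (use bilinear_M M_unit norm_b0 in auto)

section \<open>The Lipschitz constant as an infimum, and the equality case\<close>

lemma lipschitz_iff:
  "unital.lipschitz C \<longleftrightarrow> 0 \<le> C \<and>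
    (\<forall>p\<in>sphere_pts n \<times> sphere_pts n. \<forall>q\<in>sphere_pts n \<times> sphere_pts n. sph_dist n (f p) (f q) \<le> C * sphprod_dist n p q)"
    (is "_ \<longleftrightarrow> ?rhs")
proof
  assume L: "unital.lipschitz C"
  show ?rhs
  proof (intro conjI ballI)
    fix p q assume pq: "p \<in> sphere_pts n \<times> sphere_pts n" "q \<in> sphere_pts n \<times> sphere_pts n"
    have "sph_dist n (f p) (f q) = ang (F (point (fst p), point (snd p))) (F (point (fst q), point (snd q)))"
      using pq by (simp only: sph_dist_eq_ang F_point)
    also have "\<dots> \<le> C * sphprod_dist n p q"
      unfolding sphprod_dist_eq_ang using pq by (intro unital.lipschitzD[OF L]) auto
    finally show "sph_dist n (f p) (f q) \<le> C * sphprod_dist n p q" .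
  qed (use L in \<open>simp add: unital.lipschitz_def\<close>)
next
  assume ?rhs
  then have C: "0 \<le> C" and le: "sph_dist n (f p) (f q) \<le> C * sphprod_dist n p q"
    if "p \<in> sphere_pts n \<times> sphere_pts n" "q \<in> sphere_pts n \<times> sphere_pts n" for p q
    using that by blast+
  show "unital.lipschitz C"
    unfolding unital.lipschitz_def
  proof (intro conjI allI impI)
    show "0 \<le> C" using \<open>?rhs\<close> by blast
    fix x y x' y' :: 'a assume "norm x = 1" "norm y = 1" "norm x' = 1" "norm y' = 1"
    then show "ang (F (x, y)) (F (x', y')) \<le> C * sqrt ((ang x x')\<^sup>2 + (ang y y')\<^sup>2)"
      using le[of "(coords x, coords y)" "(coords x', coords y')"]
      by (simp add: F_def sph_dist_eq_ang sphprod_dist_eq_ang)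
  qed
qed

abbreviation "lip \<equiv> lip_const (sphprod_dist n) (sph_dist n) (sphere_pts n \<times> sphere_pts n) f"

lemma lip_eq_Inf: "lip = Inf {C. unital.lipschitz C}"
  by (simp only: lip_const_def lipschitz_iff)

lemma lip_le: "unital.lipschitz C \<Longrightarrow> lip \<le> C"
  unfolding lip_eq_Inf
  by (intro cInf_lower bdd_belowI[of _ "sqrt 2"]) (auto intro: unital.lipschitz_ge_sqrt2)

lemma lip_ge: "unital.lipschitz C \<Longrightarrow> sqrt 2 \<le> lip"
  unfolding lip_eq_Inf by (intro cInf_greatest) (auto intro: unital.lipschitz_ge_sqrt2)

text \<open>The infimum is attained: for points at positive distance the quotient
  \<open>?d / ?D\<close> is a lower bound of all admissible constants. The assumption keeps the set
  of these nonempty.\<close>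

lemma lipschitz_lip:
  assumes "unital.lipschitz C"
  shows "unital.lipschitz lip"
  unfolding unital.lipschitz_def
proof (intro conjI allI impI)
  show "0 \<le> lip"
    using lip_ge[OF assms] order_trans[of 0 "sqrt 2"] by simp
  fix x y x' y' :: 'a assume unit: "norm x = 1" "norm y = 1" "norm x' = 1" "norm y' = 1"
  let ?D = "sqrt ((ang x x')\<^sup>2 + (ang y y')\<^sup>2)" and ?d = "ang (F (x, y)) (F (x', y'))"
  have le: "?d \<le> C * ?D" if "unital.lipschitz C" for C
    using unital.lipschitzD[OF that unit] .
  show "?d \<le> lip * ?D"
  proof (cases "?D = 0")
    case True
    then show ?thesis using le[OF assms] by simp
  next
    case False
    moreover have "0 \<le> ?D" by simp
    ultimately have D: "0 < ?D" by linarith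
    then have "?d / ?D \<le> lip"
      unfolding lip_eq_Inf using le assms by (intro cInf_greatest) (auto simp: pos_divide_le_eq)
    then show ?thesis
      using D by (simp add: pos_divide_le_eq)
  qed
qed

lemma maps_isometric_if_lipschitz_sqrt2:
  assumes "unital.lipschitz (sqrt 2)"
  shows "maps_isometric (sphprod_dist n) (sphere_pts n \<times> sphere_pts n) (sph_dist n) (sphere_pts n) f (sph_mult n)"
proof -
  obtain B where B: "bilinear B" "\<And>x y. norm (B x y) = norm x * norm y"
      "\<And>x y. norm x = 1 \<Longrightarrow> norm y = 1 \<Longrightarrow> F (x, y) = B x y"
    using unital.bilinear_extension[OF assms] by blast
  \<comment> \<open>Kaplansky's trick: undoing \<open>R\<close> and \<open>L\<close> in the two
    arguments of \<open>B\<close> makes \<open>B (b 0) (b 0)\<close> a two-sided unit while norms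
    stay multiplicative.\<close>
  define R L where "R x = B x (b 0)" and "L y = B (b 0) y" for x y
  have R: "orthogonal_transformation R" and L: "orthogonal_transformation L"
    using B(1,2) norm_b0 unfolding orthogonal_transformation R_def L_def bilinear_def by auto
  have inv: "inv R (R x) = x" "R (inv R x) = x" "inv L (L x) = x" "L (inv L x) = x" for x
    using orthogonal_transformation_bij[OF R] orthogonal_transformation_bij[OF L]
    by (auto simp: bij_is_inj bij_is_surj surj_f_inv_f)
  have R': "orthogonal_transformation (inv R)" and L': "orthogonal_transformation (inv L)"
    using R L orthogonal_transformation_inv by auto
  interpret unitalised: normed_unital_mult "\<lambda>x y. B (inv R x) (inv L y)" "B (b 0) (b 0)"
  proof
    have "linear (\<lambda>y. B (inv R x) (inv L y))" "linear (\<lambda>y. B (inv R y) (inv L x))" for x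
      using linear_compose[of "inv L" "B (inv R x)"] linear_compose[of "inv R" "\<lambda>z. B z (inv L x)"]
        B(1) R' L' by (auto simp: bilinear_def o_def orthogonal_transformation_linear)
    then show "bilinear (\<lambda>x y. B (inv R x) (inv L y))"
      by (simp add: bilinear_def)
    show "norm (B (inv R x) (inv L y)) = norm x * norm y" for x y
      using R' L' by (simp add: B orthogonal_transformation_norm)
    have "inv R (B (b 0) (b 0)) = b 0" "inv L (B (b 0) (b 0)) = b 0"
      using inv(1)[of "b 0"] inv(3)[of "b 0"] by (simp_all add: R_def L_def)
    then show "B (inv R (B (b 0) (b 0))) (inv L x) = x" "B (inv R x) (inv L (B (b 0) (b 0))) = x" for x
      using inv(2,4)[of x] by (simp_all add: R_def L_def)
    show "norm (B (b 0) (b 0)) = 1"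
      using norm_b0 by (simp add: B)
  qed
  obtain c where c: "unitalised.cd_embedding k c"
    using unitalised.cd_embedding_exists[of k] dim n by auto
  \<comment> \<open>\<open>C\<close> sends the standard basis to the embedded one, so it is
    orthogonal and carries \<open>M\<close> to the unitalised product.\<close>
  define C where "C x = comb c (Suc n) (coords x)" for x
  have C: "orthogonal_transformation C"
    unfolding orthogonal_transformation_def
  proof (intro conjI allI linearI)
    show "C x \<bullet> C y = x \<bullet> y" for x y
      using c unfolding C_def unitalised.cd_embedding_def n(1)[symmetric] by (simp only: sum_coords)
  qed (simp_all add: C_def coords_add coords_scale comb_add comb_scale)
  have C_M: "C (M x y) = B (inv R (C x)) (inv L (C y))" for x y
    using c by (simp add: C_def coords_M unitalised.cd_embedding_def flip: n(1))
  have invC: "C (inv C x) = x" "inv C (C x) = x" for x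
    using orthogonal_transformation_bij[OF C]
    by (auto simp: bij_is_inj bij_is_surj surj_f_inv_f)
  \<comment> \<open>This is the required equivalence: \<open>inv C\<close> acts on the target,
    \<open>inv C \<circ> R\<close> and \<open>inv C \<circ> L\<close> on the two factors.\<close>
  have B_eq: "inv C (B x y) = M (inv C (R x)) (inv C (L y))" for x y
    using invC(2)[of "M (inv C (R x)) (inv C (L y))"] by (simp add: C_M invC inv)
  have inv_C: "orthogonal_transformation (inv C)"
    using C orthogonal_transformation_inv by blast
  let ?gM = "\<lambda>p. (coords ((inv C \<circ> R) (point (fst p))), coords ((inv C \<circ> L) (point (snd p))))"
  let ?gN = "\<lambda>c. coords (inv C (point c))"
  have "isometry_of (sphprod_dist n) (sphere_pts n \<times> sphere_pts n) ?gM"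
    using isometry_of_sphere_product orthogonal_transformation_compose[OF inv_C] R L by blast
  moreover have "isometry_of (sph_dist n) (sphere_pts n) ?gN"
    using inv_C by (rule isometry_of_sphere)
  moreover have "?gN (f p) = sph_mult n (?gM p)" if p: "p \<in> sphere_pts n \<times> sphere_pts n" for p
  proof -
    have "point (f p) = B (point (fst p)) (point (snd p))"
      using p by (auto simp: F_point[symmetric] B(3))
    then show ?thesis
      by (simp add: B_eq coords_M sph_mult)
  qed
  ultimately show ?thesis
    unfolding maps_isometric_def by blast
qed

text \<open>Multiplication by a unit vector preserves angles on either side, so changing one factor
  at a time costs \<open>?a + ?b\<close>, at most
  \<open>sqrt (2 * (?a\<^sup>2 + ?b\<^sup>2))\<close>.\<close>

lemma sph_mult_lipschitz:
  assumes p: "p \<in> sphere_pts n \<times> sphere_pts n" and q: "q \<in> sphere_pts n \<times> sphere_pts n"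
  shows "sph_dist n (sph_mult n p) (sph_mult n q) \<le> sqrt 2 * sphprod_dist n p q"
proof -
  obtain x y x' y' where xy: "x = point (fst p)" "y = point (snd p)" "x' = point (fst q)" "y' = point (snd q)"
    by blast
  then have unit: "norm x = 1" "norm y = 1" "norm x' = 1" "norm y' = 1"
    using p q by auto
  let ?a = "ang x x'" and ?b = "ang y y'"
  have "sph_dist n (sph_mult n p) (sph_mult n q) = ang (M x y) (M x' y')"
    by (simp only: sph_dist_eq_ang xy M_point p q)
  also have "\<dots> \<le> ang (M x y) (M x' y) + ang (M x' y) (M x' y')"
    using unit by (intro ang_triangle) (auto simp: algebra.norm_mult)
  also have "\<dots> = ?a + ?b"
    using unit by (simp add: ang_def algebra.inner_mult_left algebra.inner_mult_right norm_eq_1)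
  also have "\<dots> \<le> sqrt (2 * (?a\<^sup>2 + ?b\<^sup>2))"
    using zero_le_power2[of "?a - ?b"]
    by (intro real_le_rsqrt) (simp add: power2_eq_square algebra_simps)
  also have "\<dots> = sqrt 2 * sphprod_dist n p q"
    by (simp only: sphprod_dist_eq_ang xy real_sqrt_mult)
  finally show ?thesis .
qed

lemma lipschitz_sqrt2_if_maps_isometric:
  assumes "maps_isometric (sphprod_dist n) (sphere_pts n \<times> sphere_pts n) (sph_dist n) (sphere_pts n) f (sph_mult n)"
  shows "unital.lipschitz (sqrt 2)"
proof -
  let ?A = "sphere_pts n \<times> sphere_pts n"
  obtain gM gN where gM: "isometry_of (sphprod_dist n) ?A gM" and gN: "isometry_of (sph_dist n) (sphere_pts n) gN"
    and eq: "\<And>x. x \<in> ?A \<Longrightarrow> gN (f x) = sph_mult n (gM x)"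
    using assms unfolding maps_isometric_def by blast
  have "sph_dist n (f p) (f q) \<le> sqrt 2 * sphprod_dist n p q" if "p \<in> ?A" "q \<in> ?A" for p q
  proof -
    have "sph_dist n (f p) (f q) = sph_dist n (gN (f p)) (gN (f q))"
      using gN f_in that unfolding isometry_of_def by metis
    also have "\<dots> = sph_dist n (sph_mult n (gM p)) (sph_mult n (gM q))"
      using that by (simp only: eq)
    also have "\<dots> \<le> sqrt 2 * sphprod_dist n (gM p) (gM q)"
      using gM that unfolding isometry_of_def by (intro sph_mult_lipschitz) blast+
    also have "\<dots> = sqrt 2 * sphprod_dist n p q"
      using gM that unfolding isometry_of_def by metis
    finally show ?thesis .
  qed
  then show ?thesis
    by (simp add: lipschitz_iff)
qed

text \<open>As the infimum is attained, \<open>lip = sqrt 2\<close> makes \<open>sqrt 2\<close>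
  itself admissible and rigidity applies. Conversely, isometric equivalence makes
  \<open>sqrt 2\<close> admissible, so \<open>lip\<close> cannot exceed it.\<close>

theorem lipschitz_minimality:
  assumes "is_lipschitz (sphprod_dist n) (sph_dist n) (sphere_pts n \<times> sphere_pts n) f"
  shows "sqrt 2 \<le> lip \<and> (lip = sqrt 2 \<longleftrightarrow>
    maps_isometric (sphprod_dist n) (sphere_pts n \<times> sphere_pts n) (sph_dist n) (sphere_pts n) f (sph_mult n))"
proof -
  obtain C where C: "unital.lipschitz C"
    using assms unfolding is_lipschitz_def lipschitz_iff by blast
  then have "sqrt 2 \<le> lip"
    by (rule lip_ge)
  then show ?thesis
    using lipschitz_lip[OF C] maps_isometric_if_lipschitz_sqrt2 lipschitz_sqrt2_if_maps_isometric lip_le[of "sqrt 2"]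
    by (metis order_antisym)
qed

end

lemma coordinates_exist:
  assumes "DIM('a::euclidean_space) = Suc n" "Suc n = 2 ^ k" "1 \<le> n"
  obtains b :: "nat \<Rightarrow> 'a::euclidean_space" where "coordinates b n k"
proof -
  obtain b :: "nat \<Rightarrow> 'a" where "bij_betw b {0..<card (Basis :: 'a set)} Basis"
    using ex_bij_betw_nat_finite[OF finite_Basis] by blast
  with assms show ?thesis
    by (intro that[of b]) (simp add: coordinates_def atLeast0LessThan)
qed

theorem theorem1:
  fixes n :: nat and f :: "(nat \<Rightarrow> real) \<times> (nat \<Rightarrow> real) \<Rightarrow> (nat \<Rightarrow> real)"
  assumes "n \<in> {1, 3, 7}"
    and "f ` (sphere_pts n \<times> sphere_pts n) \<subseteq> sphere_pts n"
    and "is_lipschitz (sphprod_dist n) (sph_dist n) (sphere_pts n \<times> sphere_pts n) f"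
    and "homotopic_with_canon (\<lambda>_. True) (sphere_pts n \<times> sphere_pts n) (sphere_pts n) f (sph_mult n)"
  shows "lip_const (sphprod_dist n) (sph_dist n) (sphere_pts n \<times> sphere_pts n) f \<ge> sqrt 2
    \<and> (lip_const (sphprod_dist n) (sph_dist n) (sphere_pts n \<times> sphere_pts n) f = sqrt 2
         \<longleftrightarrow> maps_isometric (sphprod_dist n) (sphere_pts n \<times> sphere_pts n) (sph_dist n) (sphere_pts n)
               f (sph_mult n))"
proof -
  consider "n = 1" | "n = 3" | "n = 7"
    using assms(1) by auto
  then show ?thesis
  proof cases
    case 1
    \<comment> \<open>The type \<open>real^2\<close> serves as a Euclidean space of dimension
      \<open>n + 1 = 2^k\<close> with \<open>k = 1\<close>; the other cases use \<open>k = 2\<close>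
      and \<open>k = 3\<close>.\<close>
    obtain b :: "nat \<Rightarrow> real^2" where "coordinates b n 1"
      by (rule coordinates_exist[where 'a = "real^2" and n = n and k = 1]) (use 1 in auto)
    then interpret coordinates b n 1 .
    interpret sphere_map b n 1 f
      by standard (use 1 assms(4) in \<open>auto simp: sph_mult_def\<close>)
    show ?thesis
      using lipschitz_minimality[OF assms(3)] .
  next
    case 2
    obtain b :: "nat \<Rightarrow> real^4" where "coordinates b n 2"
      by (rule coordinates_exist[where 'a = "real^4" and n = n and k = 2]) (use 2 in auto)
    then interpret coordinates b n 2 .
    interpret sphere_map b n 2 f
      by standard (use 2 assms(4) in \<open>auto simp: sph_mult_def\<close>)
    show ?thesis
      using lipschitz_minimality[OF assms(3)] .
  next
    case 3
    obtain b :: "nat \<Rightarrow> real^8" where "coordinates b n 3"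
      by (rule coordinates_exist[where 'a = "real^8" and n = n and k = 3]) (use 3 in auto)
    then interpret coordinates b n 3 .
    interpret sphere_map b n 3 f
      by standard (use 3 assms(4) in \<open>auto simp: sph_mult_def\<close>)
    show ?thesis
      using lipschitz_minimality[OF assms(3)] .
  qed
qed

end
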